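(* Fix integers $b>1$ and $d\ge1$, and let $q$ be an offspring distribution with mean $m$ such that $q_0=0$, $q_1\neq1$, and $q_i=0$ for all $i>b^d$. Then for $\mathbf{P}_q$-almost every $T$ (embedded arbitrarily, with roots identified, as a subtree of the $b^d$-ary tree), the set $\Lambda=\mathcal{R}[\partial T]\subseteq[0,1]^d$ has the property that for all gauge functions $g$, $$\overline{\mathrm{Cap}}_g(\Lambda)>0\quad\text{if and only if}\quad\sum_{n=1}^\infty m^{-n}g(b^{-n})<\infty .$$
   Context: For an offspring distribution $q=(q_n)$ with $q_0=0$, $\mathbf{P}_q$ is the Galton-Watson probability measure on infinite rooted trees under which the numbers of children of the vertices are IID, equal to $n$ with probability $q_n$; $m=\sum_n nq_n$. The $b^d$-ary tree is the rooted tree in which every vertex has $b^d$ children; the edges from each vertex to its children are labelled bijectively by the vectors in $\Omega=\{0,1,\ldots,b-1\}^d$, so that its boundary (the set of infinite non-self-intersecting paths from the root) is identified with the sequence space $\Omega^{\{1,2,\ldots\}}$, and the boundary $\partial T$ of a subtree $T$ containing the root is a subset of it. The map $\mathcal{R}$ from sequences to $[0,1]^d$ is $\mathcal{R}(\omega_1,\omega_2,\ldots)=\sum_{n=1}^\infty b^{-n}\omega_n$. A gauge function here is a decreasing function $g:(0,\infty)\to(0,\infty)$ with $g(0+)=\infty$ (set $g(0)=\infty$). For a Borel measure $\theta$ on $[0,1]^d$, $\overline{\mathcal{E}}_g(\theta)=\int\int g(|x-y|)\,d\theta(x)\,d\theta(y)$ with $|\cdot|$ the Euclidean norm, and $\overline{\mathrm{Cap}}_g(\Lambda)=\big[\inf\{\overline{\mathcal{E}}_g(\theta):\theta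 \text{ a Borel probability measure},\ \theta(\Lambda)=1\}\big]^{-1}$ (with $1/\infty=0$). *)

theory Defs
  imports "HOL-Probability.Probability"
begin

section \<open>Galton-Watson trees\<close>

text \<open>Rooted trees are encoded in the Ulam-Harris way, as prefix-closed sets of finite words
  with root \<^term>\<open>[]\<close>; the children of \<^term>\<open>v\<close> are the words \<^term>\<open>v @ [k]\<close> in the tree. If
  \<^term>\<open>K v\<close> is the number of children assigned to the (potential) vertex \<^term>\<open>v\<close>, then the
  resulting tree is the following set.\<close>

definition tree_of_counts :: "(nat list \<Rightarrow> nat) \<Rightarrow> nat list set" where
  "tree_of_counts K = {v. \<forall>i<length v. v ! i < K (take i v)}"

definition tree_space :: "nat list set measure" where
  "tree_space = sigma UNIV (range (\<lambda>v. {T. v \<in> T}))"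

text \<open>The law of the tree whose child counts are IID with distribution \<^term>\<open>q\<close>. Its
  underlying space contains all sets of words, but it is concentrated on trees, and on
  infinite trees if \<^prop>\<open>pmf q 0 = 0\<close>.\<close>

definition galton_watson :: "nat pmf \<Rightarrow> nat list set measure" where
  "galton_watson q = distr (\<Pi>\<^sub>M v\<in>UNIV. measure_pmf q) tree_space tree_of_counts"

lemma space_tree_space [simp]: "space tree_space = UNIV"
  by (simp add: tree_space_def space_measure_of_conv)

lemma measurable_tree_of_counts [measurable]:
  "tree_of_counts \<in> measurable (\<Pi>\<^sub>M v\<in>UNIV. measure_pmf q) tree_space"
  unfolding tree_space_def
proof (rule measurable_measure_of)
  fix A :: "nat list set set"
  assume "A \<in> range (\<lambda>v. {T. v \<in> T})"
  then obtain v where A: "A = {T. v \<in> T}" by auto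
  have "{K \<in> space (\<Pi>\<^sub>M v\<in>UNIV. measure_pmf q). \<forall>i\<in>{..<length v}. v ! i < K (take i v)}
      \<in> sets (\<Pi>\<^sub>M v\<in>UNIV. measure_pmf q)"
    by measurable
  also have "{K \<in> space (\<Pi>\<^sub>M v\<in>UNIV. measure_pmf q). \<forall>i\<in>{..<length v}. v ! i < K (take i v)}
      = tree_of_counts -` A \<inter> space (\<Pi>\<^sub>M v\<in>UNIV. measure_pmf q)"
    by (auto simp: A tree_of_counts_def)
  finally show "tree_of_counts -` A \<inter> space (\<Pi>\<^sub>M v\<in>UNIV. measure_pmf q)
      \<in> sets (\<Pi>\<^sub>M v\<in>UNIV. measure_pmf q)" .
qed auto

lemma prob_space_galton_watson: "prob_space (galton_watson q)"
  unfolding galton_watson_def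
  by (intro prob_space.prob_space_distr prob_space_PiM measurable_tree_of_counts
      prob_space_measure_pmf)

section \<open>The $b^d$-ary tree and base-$b$ expansions\<close>

text \<open>The dimension is $d$ = \<^term>\<open>CARD('d)\<close>. The vertices of the $b^d$-ary tree are the finite
  words over \<^term>\<open>digits b\<close>.\<close>

definition digits :: "nat \<Rightarrow> (nat ^ 'd) set" where
  "digits b = {w. \<forall>i. w $ i < b}"

text \<open>The embeddings of the rooted tree \<^term>\<open>T\<close> as a subtree of the $b^d$-ary tree, with roots
  identified; the subtree is \<^term>\<open>\<phi> ` T\<close>, and its vertices are words over \<^term>\<open>digits b\<close> because
  every child in \<^term>\<open>T\<close> goes to a child in the $b^d$-ary tree.\<close>

definition tree_embedding ::
    "nat \<Rightarrow> nat list set \<Rightarrow> (nat list \<Rightarrow> (nat ^ 'd) list) \<Rightarrow> bool" where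
  "tree_embedding b T \<phi> \<longleftrightarrow>
     \<phi> [] = [] \<and> inj_on \<phi> T \<and>
     (\<forall>v k. v @ [k] \<in> T \<longrightarrow> (\<exists>w\<in>digits b. \<phi> (v @ [k]) = \<phi> v @ [w]))"

text \<open>An infinite non-self-intersecting path from the root is identified with the sequence of its
  edge labels. Sequences are indexed from \<^term>\<open>0::nat\<close>, so that \<^term>\<open>\<omega> n\<close> stands for
  $\omega_{n+1}$.\<close>

definition tree_boundary :: "'a list set \<Rightarrow> (nat \<Rightarrow> 'a) set" where
  "tree_boundary T = {\<omega>. \<forall>n. map \<omega> [0..<n] \<in> T}"

definition base_expansion :: "nat \<Rightarrow> (nat \<Rightarrow> nat ^ 'd) \<Rightarrow> real ^ 'd" where
  "base_expansion b \<omega> = (\<Sum>n. (1 / real b ^ Suc n) *\<^sub>R (\<chi> i. real (\<omega> n $ i)))"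

section \<open>Capacity\<close>

definition gauge_function :: "(real \<Rightarrow> real) \<Rightarrow> bool" where
  "gauge_function g \<longleftrightarrow>
     (\<forall>r>0. g r > 0) \<and> antimono_on {0<..} g \<and> filterlim g at_top (at_right 0)"

text \<open>Only the values of \<^term>\<open>g\<close> on the positive reals matter: the value at \<^term>\<open>0::real\<close> is
  replaced by \<^term>\<open>\<infinity> :: ennreal\<close>.\<close>

definition gauge_kernel :: "(real \<Rightarrow> real) \<Rightarrow> real \<Rightarrow> ennreal" where
  "gauge_kernel g r = (if r = 0 then \<infinity> else ennreal (g r))"

definition gauge_energy :: "(real \<Rightarrow> real) \<Rightarrow> (real ^ 'd) measure \<Rightarrow> ennreal" where
  "gauge_energy g \<theta> = (\<integral>\<^sup>+ x. (\<integral>\<^sup>+ y. gauge_kernel g (norm (x - y)) \<partial>\<theta>) \<partial>\<theta>)"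

text \<open>This is used for \<^term>\<open>\<Lambda>\<close> contained in the unit cube, in which case the Borel probability
  measures on \<^typ>\<open>real ^ 'd\<close> giving mass 1 to \<^term>\<open>\<Lambda>\<close> are those on the cube. The infimum over the
  empty set is \<^term>\<open>\<infinity> :: ennreal\<close>, and \<^prop>\<open>inverse (\<infinity> :: ennreal) = 0\<close>.\<close>

definition gauge_capacity :: "(real \<Rightarrow> real) \<Rightarrow> (real ^ 'd) set \<Rightarrow> ennreal" where
  "gauge_capacity g \<Lambda> =
     inverse (INF \<theta>\<in>{\<theta>. sets \<theta> = sets borel \<and> prob_space \<theta> \<and> emeasure \<theta> \<Lambda> = 1}.
       gauge_energy g \<theta>)"

end

theory Submission
  imports Defs
begin

text \<open>Almost surely \<open>Z\<^sub>n\<close>, the number of vertices of \<open>T\<close> at level \<open>n\<close>, is at most \<open>C m\<^sup>n\<close>, so that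
  \<open>\<Lambda>\<close> is covered by that many cubes of side \<open>b\<^sup>-\<^sup>n\<close>. By Cauchy--Schwarz, every probability measure \<open>\<theta>\<close>
  on \<open>\<Lambda>\<close> then satisfies \<open>(\<theta> \<times> \<theta>) {|x - y| \<le> b\<^sup>-\<^sup>n} \<ge> c m\<^sup>-\<^sup>n\<close>, and summation by parts turns finite energy
  into convergence of the series.

  For the converse, let \<open>W(v)\<close> be the limit of \<open>Z\<^sub>n / m\<^sup>n\<close> for the subtree at \<open>v\<close>, and let \<open>\<theta>\<close> be the image
  of the branching measure, which gives the set of rays through \<open>v\<close> the mass proportional to
  \<open>m\<^sup>-\<^sup>|\<^sup>v\<^sup>| W(v)\<close>. The law of large numbers for the \<open>W(v)\<^sup>2\<close> with \<open>|v| = n\<close> shows that the squares of these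
  masses add up to at most \<open>C m\<^sup>-\<^sup>n\<close> at level \<open>n\<close>, for all \<open>n\<close> simultaneously. As a cube has boundedly
  many neighbours, \<open>(\<theta> \<times> \<theta>) {|x - y| \<le> b\<^sup>-\<^sup>n} \<le> C' m\<^sup>-\<^sup>n\<close>, whence \<open>\<theta>\<close> has finite energy for every gauge whose
  series converges.

  Martingale theory is avoided: sums over level \<open>n\<close> of IID centred variables with finite variance have
  \<open>L\<^sup>2\<close> norm of order \<open>m\<^sup>n\<^sup>/\<^sup>2\<close>, hence divided by \<open>m\<^sup>n\<close> they are almost surely absolutely summable. This
  gives both the convergence of \<open>Z\<^sub>n / m\<^sup>n\<close> and the law of large numbers; the fourth moment of \<open>W\<close> needed
  for the latter comes from an exponential moment.\<close>

section \<open>Cubes and boundaries of trees of digit words\<close>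

text \<open>Reading \<open>v\<close> in base \<open>b\<close> coordinate by coordinate gives the
  lower corner of its cube, scaled by \<open>b ^ length v\<close> to stay in the integers.\<close>

definition corner :: "nat \<Rightarrow> (nat ^ 'd) list \<Rightarrow> nat ^ 'd" where
  "corner b v = (\<chi> i. foldl (\<lambda>c w. b * c + w $ i) 0 v)"

text \<open>These are closed cubes of side \<open>1 / b ^ length v\<close>, so cubes of one level
  may share faces. Closedness admits expansions ending in repeated digits \<open>b - 1\<close> and
  makes finite unions of cubes closed.\<close>

definition cell :: "nat \<Rightarrow> (nat ^ 'd) list \<Rightarrow> (real ^ 'd) set" where
  "cell b v = {x. \<forall>i. real (corner b v $ i) \<le> real b ^ length v * x $ i \<and>
     real b ^ length v * x $ i \<le> real (corner b v $ i) + 1}"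

lemma corner_Nil [simp]: "corner b [] = 0"
  by (simp add: corner_def vec_eq_iff)

lemma corner_snoc [simp]: "corner b (v @ [w]) = (\<chi> i. b * corner b v $ i + w $ i)"
  by (simp add: corner_def vec_eq_iff)

text \<open>In each coordinate, the last digit and the corner of the remaining word are remainder
  and quotient modulo \<open>b\<close>.\<close>

lemma corner_inj:
  assumes "length v = length w" "set v \<subseteq> digits b" "set w \<subseteq> digits b" "corner b v = corner b w"
  shows "v = w"
  using assms
proof (induction v arbitrary: w rule: rev_induct)
  case (snoc x v)
  then obtain w' y where w: "w = w' @ [y]"
    by (metis append_butlast_last_id length_0_conv append_is_Nil_conv not_Cons_self2)
  have *: "b * corner b v $ i + x $ i = b * corner b w' $ i + y $ i" "x $ i < b" "y $ i < b" for i
    using snoc.prems by (auto simp: w vec_eq_iff digits_def)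
  have x: "x $ i = y $ i" for i
    using arg_cong[OF *(1)[of i], of "\<lambda>n. n mod b"] *(2,3)[of i] by simp
  have "corner b v $ i = corner b w' $ i" for i
    using arg_cong[OF *(1)[of i], of "\<lambda>n. n div b"] *(2,3)[of i] by simp
  then show ?case
    using snoc.IH[of w'] snoc.prems x by (auto simp: w vec_eq_iff)
qed auto

lemma closed_cell: "closed (cell b v :: (real ^ 'd) set)"
proof -
  have "cell b v = (\<Inter>i. {x :: real ^ 'd. real (corner b v $ i) \<le> real b ^ length v * x $ i} \<inter>
     {x. real b ^ length v * x $ i \<le> real (corner b v $ i) + 1})"
    by (auto simp: cell_def)
  then show ?thesis
    by (auto intro!: closed_INT closed_Int closed_Collect_le continuous_intros)
qed

lemma cell_snoc_subset:
  assumes "w \<in> digits b"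
  shows "cell b (v @ [w]) \<subseteq> cell b v"
proof
  fix x assume x: "x \<in> cell b (v @ [w])"
  have "real (corner b v $ i) \<le> real b ^ length v * x $ i \<and>
     real b ^ length v * x $ i \<le> real (corner b v $ i) + 1" for i
  proof -
    have "w $ i < b"
      using assms by (simp add: digits_def)
    then have w: "real (w $ i) \<le> real b - 1" and b: "real b > 0"
      by linarith+
    have "real b * real (corner b v $ i) + real (w $ i) \<le> real b * (real b ^ length v * x $ i)"
      "real b * (real b ^ length v * x $ i) \<le> real b * real (corner b v $ i) + real (w $ i) + 1"
      using x by (auto simp: cell_def mult.assoc)
    with w have "real b * real (corner b v $ i) \<le> real b * (real b ^ length v * x $ i)"
      "real b * (real b ^ length v * x $ i) \<le> real b * (real (corner b v $ i) + 1)"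
      unfolding distrib_left by linarith+
    with b show ?thesis
      by simp
  qed
  then show "x \<in> cell b v"
    by (simp add: cell_def)
qed

lemma cell_prefix_subset:
  assumes "\<And>n. \<omega> n \<in> digits b" "n \<le> k"
  shows "cell b (map \<omega> [0..<k]) \<subseteq> cell b (map \<omega> [0..<n])"
  using assms(2)
proof (induction k rule: dec_induct)
  case (step k)
  then show ?case
    using cell_snoc_subset[OF assms(1)] by (simp add: subset_iff)
qed simp

text \<open>The Euclidean norm is at most the sum of the coordinate differences; the cruder factor
  \<open>CARD('d)\<close> in place of its square root only affects constants.\<close>

lemma norm_diff_cell:
  fixes x y :: "real ^ 'd"
  assumes "x \<in> cell b v" "y \<in> cell b v" "b > 0"
  shows "norm (x - y) \<le> real CARD('d) / real b ^ length v"
proof -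
  have "\<bar>(x - y) $ i\<bar> \<le> 1 / real b ^ length v" for i
  proof -
    have "\<bar>real b ^ length v * x $ i - real b ^ length v * y $ i\<bar> \<le> 1"
      using assms unfolding cell_def by (smt (verit) mem_Collect_eq)
    then have "real b ^ length v * \<bar>x $ i - y $ i\<bar> \<le> 1"
      by (simp add: abs_mult flip: right_diff_distrib)
    then show ?thesis
      using assms by (simp add: field_simps)
  qed
  then have "(\<Sum>i\<in>UNIV. \<bar>(x - y) $ i\<bar>) \<le> (\<Sum>i\<in>(UNIV::'d set). 1 / real b ^ length v)"
    by (intro sum_mono) simp
  then show ?thesis
    using norm_le_l1_cart[of "x - y"] by simp
qed

lemma summable_base_expansion:
  fixes \<omega> :: "nat \<Rightarrow> nat ^ 'd"
  assumes "b > 1" "\<And>n. \<omega> n \<in> digits b"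
  shows "summable (\<lambda>n. (1 / real b ^ Suc n) *\<^sub>R (\<chi> i. real (\<omega> n $ i)) :: real ^ 'd)"
proof (rule summable_comparison_test')
  show "summable (\<lambda>n. real CARD('d) * (1 / real b) ^ n)"
    using assms by (intro summable_mult summable_geometric) simp
  fix n
  have "norm (\<chi> i. real (\<omega> n $ i) :: real ^ 'd) \<le> (\<Sum>i\<in>(UNIV::'d set). real b)"
    using assms(2)[of n]
    by (intro order.trans[OF norm_le_l1_cart] sum_mono) (auto simp: digits_def less_imp_le)
  then show "norm ((1 / real b ^ Suc n) *\<^sub>R (\<chi> i. real (\<omega> n $ i)) :: real ^ 'd)
      \<le> real CARD('d) * (1 / real b) ^ n"
    using assms by (simp add: field_simps)
qed

lemma base_expansion_partial_sum:
  fixes \<omega> :: "nat \<Rightarrow> nat ^ 'd"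
  assumes "b > 1"
  shows "(\<Sum>k<n. (1 / real b ^ Suc k) *\<^sub>R (\<chi> i. real (\<omega> k $ i)) :: real ^ 'd)
    = (\<chi> i. real (corner b (map \<omega> [0..<n]) $ i) / real b ^ n)"
  by (induction n) (use assms in \<open>auto simp: vec_eq_iff field_simps\<close>)

lemma corner_LIMSEQ_base_expansion:
  fixes \<omega> :: "nat \<Rightarrow> nat ^ 'd"
  assumes "b > 1" "\<And>n. \<omega> n \<in> digits b"
  shows "(\<lambda>n. (\<chi> i. real (corner b (map \<omega> [0..<n]) $ i) / real b ^ n))
    \<longlonglongrightarrow> (base_expansion b \<omega> :: real ^ 'd)"
  using summable_LIMSEQ[OF summable_base_expansion[OF assms]]
  unfolding base_expansion_partial_sum[OF assms(1)] base_expansion_def .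

text \<open>The partial sums are the rescaled corners. By nesting they stay in the given cube from
  index \<open>n\<close> on, and so does their limit because the cube is closed.\<close>

lemma base_expansion_in_cell:
  fixes \<omega> :: "nat \<Rightarrow> nat ^ 'd"
  assumes "b > 1" "\<And>n. \<omega> n \<in> digits b"
  shows "base_expansion b \<omega> \<in> cell b (map \<omega> [0..<n])"
proof -
  have "(\<chi> i. real (corner b (map \<omega> [0..<k]) $ i) / real b ^ k) \<in> cell b (map \<omega> [0..<k])" for k
    using assms by (simp add: cell_def)
  then have "\<forall>\<^sub>F k in sequentially. (\<chi> i. real (corner b (map \<omega> [0..<k]) $ i) / real b ^ k)
      \<in> cell b (map \<omega> [0..<n])"
    using cell_prefix_subset[OF assms(2)] by (intro eventually_sequentiallyI[of n]) (rule subsetD)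
  then show ?thesis
    by (rule Lim_in_closed_set[OF closed_cell _ sequentially_bot corner_LIMSEQ_base_expansion[OF assms]])
qed

lemma eq_base_expansionI:
  fixes x :: "real ^ 'd"
  assumes "b > 1" "\<And>n. \<omega> n \<in> digits b" "\<And>n. x \<in> cell b (map \<omega> [0..<n])"
  shows "x = base_expansion b \<omega>"
proof -
  have "norm (x - base_expansion b \<omega>) \<le> real CARD('d) / real b ^ n" for n
    using norm_diff_cell[OF assms(3) base_expansion_in_cell[OF assms(1,2)], of n] assms(1) by simp
  moreover have "(\<lambda>n. real CARD('d) / real b ^ n) \<longlonglongrightarrow> 0"
    using assms(1) by (intro LIMSEQ_divide_realpow_zero) simp
  ultimately have "norm (x - base_expansion b \<omega>) \<le> 0"
    by (meson LIMSEQ_le_const)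
  then show ?thesis by simp
qed

lemma finite_digits [simp]: "finite (digits b :: (nat ^ 'd) set)"
proof -
  have "digits b \<subseteq> (\<lambda>f. \<chi> i. f i) ` (PiE (UNIV :: 'd set) (\<lambda>_. {..<b}))"
  proof
    fix w :: "nat ^ 'd" assume "w \<in> digits b"
    then show "w \<in> (\<lambda>f. \<chi> i. f i) ` (PiE (UNIV :: 'd set) (\<lambda>_. {..<b}))"
      by (intro image_eqI[of _ _ "\<lambda>i. w $ i"]) (auto simp: digits_def)
  qed
  then show ?thesis
    by (rule finite_subset) (simp add: finite_PiE)
qed

locale digit_tree =
  fixes b :: nat and A :: "(nat ^ 'd) list set"
  assumes b: "b > 1"
    and words: "A \<subseteq> lists (digits b)"
    and root: "[] \<in> A"
    and butlast: "v @ [w] \<in> A \<Longrightarrow> v \<in> A"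
begin

definition level :: "nat \<Rightarrow> (nat ^ 'd) list set" where
  "level n = {v \<in> A. length v = n}"

lemma finite_level [simp]: "finite (level n)"
  by (rule finite_subset[OF _ finite_lists_length_eq[OF finite_digits[of b], of n]])
    (use words in \<open>auto simp: level_def\<close>)

lemma prefix_in: "u @ v \<in> A \<Longrightarrow> u \<in> A"
proof (induction v rule: rev_induct)
  case (snoc x v)
  then show ?case using butlast[of "u @ v" x] by simp
qed simp

lemma digits_boundary:
  assumes "\<omega> \<in> tree_boundary A"
  shows "\<omega> n \<in> digits b"
proof -
  have "map \<omega> [0..<Suc n] \<in> lists (digits b)"
    using assms words unfolding tree_boundary_def by blast
  then show ?thesis by simp
qed

text \<open>A ray gives a point in the cubes of all levels by nesting. The converse is Koenig's
  lemma: vertices whose cube contains \<open>x\<close> occur at every level, and branching is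
  finite, so some ray consists of such vertices. The right-hand side shows that the image is closed,
  hence Borel.\<close>

lemma boundary_image:
  "base_expansion b ` tree_boundary A = (\<Inter>n. \<Union>v\<in>level n. cell b v)"
proof (intro set_eqI iffI)
  fix x assume "x \<in> base_expansion b ` tree_boundary A"
  then obtain \<omega> where \<omega>: "\<omega> \<in> tree_boundary A" "x = base_expansion b \<omega>" by auto
  have "map \<omega> [0..<n] \<in> level n" "x \<in> cell b (map \<omega> [0..<n])" for n
    using base_expansion_in_cell[of b \<omega> n] digits_boundary b \<omega>
    by (auto simp: level_def tree_boundary_def)
  then show "x \<in> (\<Inter>n. \<Union>v\<in>level n. cell b v)" by blast
next
  fix x assume x: "x \<in> (\<Inter>n. \<Union>v\<in>level n. cell b v)"
  \<comment> \<open>\<open>D v\<close> collects the continuations of \<open>v\<close> inside the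
    tree that end at a cube containing \<open>x\<close>; the ray will run through vertices with
    infinite \<open>D\<close>.\<close>
  define D where "D v = {u. v @ u \<in> A \<and> x \<in> cell b (v @ u)}" for v
  have cell_prefix: "x \<in> cell b v" if "x \<in> cell b (v @ u)" "v @ u \<in> A" for u v
    using that
  proof (induction u rule: rev_induct)
    case (snoc w u)
    have "w \<in> digits b"
      using snoc.prems words by auto
    then show ?case
      using snoc cell_snoc_subset[of w b "v @ u"] butlast[of "v @ u" w] by auto
  qed simp
  have "infinite (D [])"
  proof
    assume "finite (D [])"
    then have fin: "finite (length ` D [])" by simp
    have "n \<in> length ` D []" for n
    proof -
      obtain v where "v \<in> level n" "x \<in> cell b v"
        using x by blast
      then show ?thesis by (auto simp: D_def level_def)
    qed
    then have "length ` D [] = UNIV" by blast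
    with fin show False by simp
  qed
  \<comment> \<open>There are only finitely many digits, so if each one left finitely many
    continuations, \<open>v\<close> itself would have finitely many.\<close>
  have step: "\<exists>w\<in>digits b. infinite (D (v @ [w]))" if "infinite (D v)" for v
  proof (rule ccontr)
    assume "\<not> ?thesis"
    then have fin: "finite ({[]} \<union> (\<Union>w\<in>digits b. (#) w ` D (v @ [w])))" by auto
    have "D v \<subseteq> {[]} \<union> (\<Union>w\<in>digits b. (#) w ` D (v @ [w]))"
    proof
      fix u assume u: "u \<in> D v"
      show "u \<in> {[]} \<union> (\<Union>w\<in>digits b. (#) w ` D (v @ [w]))"
      proof (cases u)
        case (Cons w u')
        then have "w \<in> digits b" "u' \<in> D (v @ [w])"
          using u words by (auto simp: D_def)
        then show ?thesis using Cons by auto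
      qed simp
    qed
    then show False
      using that fin finite_subset by blast
  qed
  define f where "f v = (SOME w. w \<in> digits b \<and> infinite (D (v @ [w])))" for v
  define p where "p = rec_nat [] (\<lambda>_ v. v @ [f v])"
  have p_simps: "p 0 = []" "p (Suc n) = p n @ [f (p n)]" for n
    by (simp_all add: p_def)
  define \<omega> where "\<omega> n = f (p n)" for n
  have p_eq: "p n = map \<omega> [0..<n]" for n
    by (induction n) (auto simp: p_simps \<omega>_def)
  have f: "f v \<in> digits b \<and> infinite (D (v @ [f v]))" if "infinite (D v)" for v
    unfolding f_def by (rule someI_ex) (use step[OF that] in blast)
  have inf: "infinite (D (p n))" for n
    by (induction n) (use \<open>infinite (D [])\<close> f in \<open>auto simp: p_simps\<close>)
  \<comment> \<open>One continuation is enough: prefix closure puts \<open>p n\<close> into the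
    tree, and nesting puts \<open>x\<close> into its cube.\<close>
  have mem: "p n \<in> A \<and> x \<in> cell b (p n)" for n
  proof -
    obtain u where "u \<in> D (p n)"
      using infinite_imp_nonempty[OF inf[of n]] by blast
    then show ?thesis
      using cell_prefix[of "p n" u] prefix_in[of "p n" u] by (auto simp: D_def)
  qed
  have "\<omega> n \<in> digits b" for n
    using f[OF inf[of n]] by (simp add: \<omega>_def)
  then have "x = base_expansion b \<omega>"
    using mem b by (intro eq_base_expansionI) (auto simp: p_eq)
  moreover have "\<omega> \<in> tree_boundary A"
    using mem by (auto simp: tree_boundary_def p_eq)
  ultimately show "x \<in> base_expansion b ` tree_boundary A" by blast
qed

lemma closed_boundary_image: "closed (base_expansion b ` tree_boundary A :: (real ^ 'd) set)"
  unfolding boundary_image by (intro closed_INT ballI closed_UN finite_level closed_cell)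

end

section \<open>Energy and the mass of pairs of close points\<close>

lemma gauge_function_antimonoD:
  assumes "gauge_function g" "0 < r" "r \<le> s"
  shows "g s \<le> g r"
  using assms by (auto simp: gauge_function_def monotone_on_def)

lemma gauge_function_pos: "gauge_function g \<Longrightarrow> 0 < r \<Longrightarrow> 0 < g r"
  by (simp add: gauge_function_def)

text \<open>Pointwise summation by parts: the increments whose indicator is 1 telescope to
  \<open>g\<close> at a scale not below \<open>r\<close>, minus \<open>g 1\<close>, and
  \<open>g\<close> is decreasing and positive.\<close>

lemma gauge_kernel_ge_sum:
  assumes g: "gauge_function g" and b: "b > 1" and r: "0 \<le> r"
  shows "(\<Sum>n<N. ennreal (g (1 / real b ^ Suc n) - g (1 / real b ^ n)) *
    indicator {..1 / real b ^ Suc n} r) \<le> gauge_kernel g r"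
proof (cases "r = 0")
  case False
  define s where "s n = 1 / real b ^ n" for n
  have s: "s n > 0" "s (Suc n) \<le> s n" for n
    using b by (auto simp: s_def field_simps)
  have anti: "decseq s"
    using s(2) by (simp add: decseq_Suc_iff)
  have "(\<Sum>n<N. (g (s (Suc n)) - g (s n)) * indicator {..s (Suc n)} r) \<le> g r" for N
  proof (induction N)
    case 0
    then show ?case using gauge_function_pos[OF g, of r] r False by simp
  next
    case (Suc N)
    show ?case
    proof (cases "r \<le> s (Suc N)")
      case True
      have "r \<le> s (Suc n)" if "n < Suc N" for n
        using True decseqD[OF anti, of "Suc n" "Suc N"] that by simp
      then have "(\<Sum>n<Suc N. (g (s (Suc n)) - g (s n)) * indicator {..s (Suc n)} r)
          = (\<Sum>n<Suc N. g (s (Suc n)) - g (s n))"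
        by (intro sum.cong) auto
      also have "\<dots> = g (s (Suc N)) - g (s 0)"
        by (rule sum_lessThan_telescope)
      also have "\<dots> \<le> g r"
        using gauge_function_antimonoD[OF g _ True] gauge_function_pos[OF g s(1)[of 0]] r False by simp
      finally show ?thesis .
    qed (use Suc in simp)
  qed
  then have "ennreal (\<Sum>n<N. (g (s (Suc n)) - g (s n)) * indicator {..s (Suc n)} r) \<le> ennreal (g r)"
    by (rule ennreal_leI)
  also have "ennreal (\<Sum>n<N. (g (s (Suc n)) - g (s n)) * indicator {..s (Suc n)} r)
      = (\<Sum>n<N. ennreal (g (s (Suc n)) - g (s n)) * indicator {..s (Suc n)} r)"
    using gauge_function_antimonoD[OF g s]
    by (subst sum_ennreal[symmetric])
      (auto intro!: sum.cong simp: ennreal_mult ennreal_indicator)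
  finally show ?thesis
    using False by (simp add: gauge_kernel_def s_def)
qed (simp add: gauge_kernel_def)

text \<open>For \<open>0 < r \<le> 1\<close> a single term of the series is enough, the one with
  \<open>1 / b ^ Suc k < r \<le> 1 / b ^ k\<close>; the summand \<open>g 1\<close> takes care of
  \<open>r > 1\<close>.\<close>

lemma gauge_kernel_le_suminf:
  assumes g: "gauge_function g" and b: "b > 1" and r: "0 \<le> r"
  shows "gauge_kernel g r \<le> ennreal (g 1) +
    (\<Sum>n. ennreal (g (1 / real b ^ Suc n)) * indicator {..1 / real b ^ n} r)"
    (is "_ \<le> _ + suminf ?f")
proof -
  have le: "?f n \<le> suminf ?f" for n
    using sum_le_suminf[of ?f "{n}"] by (simp del: sum_mult_indicator)
  consider "r = 0" | "r > 1" | "0 < r" "r \<le> 1"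
    using r by linarith
  then show ?thesis
  proof cases
    case 1
    \<comment> \<open>At \<open>r = 0\<close> the kernel is infinite. All indicators are then 1, and
      \<open>g(0+) = \<infinity>\<close> makes the terms unbounded, so the series is infinite as
      well.\<close>
    have "filterlim (\<lambda>n. 1 / real b ^ Suc n) (at_right 0) sequentially"
      using b by real_asymp
    then have "filterlim (\<lambda>n. g (1 / real b ^ Suc n)) at_top sequentially"
      using g filterlim_compose unfolding gauge_function_def by blast
    then have *: "\<exists>n. real N \<le> g (1 / real b ^ Suc n)" for N
      by (auto simp: filterlim_at_top eventually_sequentially)
    have "of_nat N \<le> suminf ?f" for N
    proof -
      obtain n where "real N \<le> g (1 / real b ^ Suc n)"
        using * by blast
      then have "of_nat N \<le> ?f n"
        using 1 by (simp add: ennreal_of_nat_eq_real_of_nat ennreal_leI)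
      with le[of n] show ?thesis by (rule order.trans[rotated])
    qed
    then have "suminf ?f = \<top>"
      using ennreal_Ex_less_of_nat[of "suminf ?f"] by (auto simp: less_top[symmetric] not_less[symmetric])
    then show ?thesis by simp
  next
    case 2
    then have "gauge_kernel g r \<le> ennreal (g 1)"
      using gauge_function_antimonoD[OF g, of 1 r] by (simp add: gauge_kernel_def ennreal_leI)
    then show ?thesis by (simp add: add_increasing2)
  next
    case 3
    have "\<exists>n. 1 / real b ^ n < r"
      using 3 b real_arch_pow_inv[of r "1 / real b"] by (auto simp: power_one_over)
    \<comment> \<open>The least such \<open>n\<close> is not 0 because \<open>r \<le> 1\<close>; its
      predecessor is the required scale.\<close>
    then obtain n where n: "1 / real b ^ n < r" "\<And>k. k < n \<Longrightarrow> \<not> 1 / real b ^ k < r"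
      using exists_least_iff[of "\<lambda>n. 1 / real b ^ n < r"] by blast
    with 3 obtain k where k: "n = Suc k"
      by (cases n) auto
    have "gauge_kernel g r \<le> ennreal (g (1 / real b ^ Suc k))"
      using 3 n(1) b gauge_function_antimonoD[OF g, of "1 / real b ^ n" r] k
      by (auto simp: gauge_kernel_def intro!: ennreal_leI)
    also have "\<dots> = ?f k"
      using n(2)[of k] k by simp
    also have "\<dots> \<le> suminf ?f" by (rule le)
    finally show ?thesis by (simp add: add_increasing)
  qed
qed

text \<open>This is the product-measure mass of the pairs at distance at most \<open>r\<close>, as
  an iterated integral to match \<open>gauge_energy\<close>.\<close>

definition close_mass :: "(real ^ 'd) measure \<Rightarrow> real \<Rightarrow> ennreal" where
  "close_mass \<theta> r = (\<integral>\<^sup>+ x. (\<integral>\<^sup>+ y. indicator {..r} (norm (x - y)) \<partial>\<theta>) \<partial>\<theta>)"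

context
  fixes \<theta> :: "(real ^ 'd) measure" and g :: "real \<Rightarrow> real" and b :: nat
  assumes g: "gauge_function g" and b: "b > 1" and sets_\<theta> [measurable_cong]: "sets \<theta> = sets borel"
    and prob_\<theta>: "prob_space \<theta>"
begin

interpretation prob_space \<theta> by (rule prob_\<theta>)

lemma gauge_energy_ge_sum:
  "(\<Sum>n<N. ennreal (g (1 / real b ^ Suc n) - g (1 / real b ^ n)) * close_mass \<theta> (1 / real b ^ Suc n))
    \<le> gauge_energy g \<theta>"
proof -
  have "(\<Sum>n<N. ennreal (g (1 / real b ^ Suc n) - g (1 / real b ^ n)) * close_mass \<theta> (1 / real b ^ Suc n))
    = (\<integral>\<^sup>+ x. \<integral>\<^sup>+ y. (\<Sum>n<N. ennreal (g (1 / real b ^ Suc n) - g (1 / real b ^ n)) *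
    indicator {..1 / real b ^ Suc n} (norm (x - y))) \<partial>\<theta> \<partial>\<theta>)"
    by (simp add: close_mass_def nn_integral_sum nn_integral_cmult del: power_Suc sum_mult_indicator)
  also have "\<dots> \<le> gauge_energy g \<theta>"
    unfolding gauge_energy_def
    by (intro nn_integral_mono gauge_kernel_ge_sum g b) simp
  finally show ?thesis .
qed

lemma gauge_energy_le_suminf:
  "gauge_energy g \<theta> \<le> ennreal (g 1) +
    (\<Sum>n. ennreal (g (1 / real b ^ Suc n)) * close_mass \<theta> (1 / real b ^ n))"
proof -
  have "gauge_energy g \<theta> \<le> (\<integral>\<^sup>+ x. \<integral>\<^sup>+ y. ennreal (g 1) +
    (\<Sum>n. ennreal (g (1 / real b ^ Suc n)) * indicator {..1 / real b ^ n} (norm (x - y))) \<partial>\<theta> \<partial>\<theta>)"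
    unfolding gauge_energy_def
    by (intro nn_integral_mono gauge_kernel_le_suminf g b) simp
  also have "\<dots> = ennreal (g 1) +
    (\<Sum>n. ennreal (g (1 / real b ^ Suc n)) * close_mass \<theta> (1 / real b ^ n))"
    by (simp add: close_mass_def nn_integral_add nn_integral_suminf nn_integral_cmult
        emeasure_space_1 del: power_Suc)
  finally show ?thesis .
qed

text \<open>The energy bounds the increments of \<open>g\<close> along the scales, weighted by
  \<open>c / m ^ Suc n\<close>. Summation by parts recovers the values of \<open>g\<close>, at the
  price of the factor \<open>1 - 1 / m\<close>, which is positive since
  \<open>m > 1\<close>.\<close>

lemma summable_of_finite_energy:
  assumes m: "m > 1" and c: "c > 0"
    and mass: "\<And>n. ennreal (c / m ^ n) \<le> close_mass \<theta> (1 / real b ^ n)"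
    and fin: "gauge_energy g \<theta> < \<infinity>"
  shows "(\<Sum>n. ennreal (g (1 / real b ^ Suc n) / m ^ Suc n)) < \<infinity>"
proof -
  define s where "s n = g (1 / real b ^ n)" for n
  have s: "s n > 0" "s n \<le> s (Suc n)" for n
    using b by (auto simp: s_def field_simps intro!: gauge_function_pos[OF g] gauge_function_antimonoD[OF g])
  obtain e where e: "e \<ge> 0" "gauge_energy g \<theta> = ennreal e"
    using fin by (cases "gauge_energy g \<theta>") auto
  have "(\<Sum>n<N. s (Suc n) / m ^ Suc n) \<le> (e / c + s 0 / m) / (1 - 1 / m)" for N
  proof -
    have "ennreal (\<Sum>n<N. (s (Suc n) - s n) * (c / m ^ Suc n))
        = (\<Sum>n<N. ennreal ((s (Suc n) - s n) * (c / m ^ Suc n)))"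
      using s m c by (intro sum_ennreal[symmetric] mult_nonneg_nonneg) auto
    also have "\<dots> = (\<Sum>n<N. ennreal (s (Suc n) - s n) * ennreal (c / m ^ Suc n))"
      using s m c by (intro sum.cong refl ennreal_mult) auto
    also have "\<dots> \<le> (\<Sum>n<N. ennreal (s (Suc n) - s n) * close_mass \<theta> (1 / real b ^ Suc n))"
      by (intro sum_mono mult_left_mono mass) simp
    also have "\<dots> \<le> ennreal e"
      using gauge_energy_ge_sum[of N] e by (simp add: s_def)
    finally have "(\<Sum>n<N. (s (Suc n) - s n) * (c / m ^ Suc n)) \<le> e"
      using e by simp
    also have "(\<Sum>n<N. (s (Suc n) - s n) * (c / m ^ Suc n)) = c * (\<Sum>n<N. (s (Suc n) - s n) / m ^ Suc n)"
      by (simp add: sum_distrib_left mult_ac)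
    finally have "(\<Sum>n<N. (s (Suc n) - s n) / m ^ Suc n) \<le> e / c"
      using c by (simp add: field_simps)
    moreover have "(\<Sum>n<N. (s (Suc n) - s n) / m ^ Suc n)
        = (\<Sum>n<N. s (Suc n) / m ^ Suc n) * (1 - 1 / m) - s 0 / m + s N / m ^ Suc N"
    proof (induction N)
      case (Suc N)
      have "(s (Suc N) - s N) / m ^ Suc N = s (Suc N) / m ^ Suc N * (1 - 1 / m)
          - s N / m ^ Suc N + s (Suc N) / m ^ Suc (Suc N)"
        using m by (simp add: field_simps)
      with Suc show ?case by (simp only: sum.lessThan_Suc distrib_right)
    qed simp
    moreover have "s N / m ^ Suc N \<ge> 0"
      using s(1)[of N] m by simp
    ultimately have "(\<Sum>n<N. s (Suc n) / m ^ Suc n) * (1 - 1 / m) \<le> e / c + s 0 / m"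
      by linarith
    then show ?thesis
      using m by (simp add: pos_le_divide_eq)
  qed
  then have "(\<Sum>n<N. ennreal (s (Suc n) / m ^ Suc n)) \<le> ennreal ((e / c + s 0 / m) / (1 - 1 / m))" for N
    using s(1)[THEN less_imp_le] m by (subst sum_ennreal) (auto intro!: ennreal_leI divide_nonneg_pos)
  then have "(\<Sum>n. ennreal (s (Suc n) / m ^ Suc n)) \<le> ennreal ((e / c + s 0 / m) / (1 - 1 / m))"
    unfolding suminf_eq_SUP by (intro SUP_least)
  then show ?thesis
    unfolding s_def infinity_ennreal_def by (rule le_less_trans) simp
qed

text \<open>In the upper bound for the energy, \<open>g\<close> is taken one scale below the close
  pairs; this shift of index costs a factor \<open>m\<close>.\<close>

lemma finite_energy_of_summable:
  assumes m: "m > 1"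
    and mass: "\<And>n. close_mass \<theta> (1 / real b ^ n) \<le> ennreal (C / m ^ n)"
    and fin: "(\<Sum>n. ennreal (g (1 / real b ^ Suc n) / m ^ Suc n)) < \<infinity>"
  shows "gauge_energy g \<theta> < \<infinity>"
proof -
  have "(\<Sum>n. ennreal (g (1 / real b ^ Suc n)) * close_mass \<theta> (1 / real b ^ n))
      \<le> (\<Sum>n. ennreal (C * m) * ennreal (g (1 / real b ^ Suc n) / m ^ Suc n))"
  proof (intro suminf_le summableI)
    fix n
    have pos: "0 < g (1 / real b ^ Suc n)"
      using b by (intro gauge_function_pos[OF g]) simp
    have "ennreal (g (1 / real b ^ Suc n)) * close_mass \<theta> (1 / real b ^ n)
        \<le> ennreal (g (1 / real b ^ Suc n)) * ennreal (C / m ^ n)"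
      by (intro mult_left_mono mass) simp
    also have "\<dots> = ennreal (C * m * (g (1 / real b ^ Suc n) / m ^ Suc n))"
      using m pos by (subst ennreal_mult'[symmetric]) (auto simp: mult_ac)
    also have "\<dots> = ennreal (C * m) * ennreal (g (1 / real b ^ Suc n) / m ^ Suc n)"
      using m pos by (subst ennreal_mult'') (auto simp del: power_Suc)
    finally show "ennreal (g (1 / real b ^ Suc n)) * close_mass \<theta> (1 / real b ^ n)
      \<le> ennreal (C * m) * ennreal (g (1 / real b ^ Suc n) / m ^ Suc n)" .
  qed
  also have "\<dots> = ennreal (C * m) * (\<Sum>n. ennreal (g (1 / real b ^ Suc n) / m ^ Suc n))"
    by simp
  also have "\<dots> < \<top>"
    using fin by (simp add: ennreal_mult_less_top)
  finally have "ennreal (g 1) + (\<Sum>n. ennreal (g (1 / real b ^ Suc n)) * close_mass \<theta> (1 / real b ^ n)) < \<top>"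
    by simp
  with gauge_energy_le_suminf show ?thesis
    by (simp add: order.strict_trans1)
qed

end

text \<open>If the cover is made disjoint, then \<^term>\<open>\<theta> \<Otimes>\<^sub>M \<theta>\<close> gives mass \<open>\<Sum>i<N. (\<theta> (B i))\<^sup>2\<close> to the pairs
  lying in a common piece, and Cauchy--Schwarz bounds this from below.\<close>

lemma close_mass_ge_cover:
  fixes D :: "nat \<Rightarrow> (real ^ 'd) set"
  assumes sets_\<theta> [measurable_cong]: "sets \<theta> = sets borel" and "prob_space \<theta>"
    and D: "\<And>i. D i \<in> sets borel" and cover: "AE x in \<theta>. x \<in> (\<Union>i<N. D i)"
    and diam: "\<And>i x y. i < N \<Longrightarrow> x \<in> D i \<Longrightarrow> y \<in> D i \<Longrightarrow> norm (x - y) \<le> r"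
  shows "ennreal (1 / real N) \<le> close_mass \<theta> r"
proof -
  interpret prob_space \<theta> by fact
  define B where "B = disjointed D"
  have B [measurable]: "B i \<in> sets borel" for i
    using sets.range_disjointed_sets[of D borel] D by (auto simp: B_def)
  have disj: "disjoint_family B"
    by (simp add: B_def disjoint_family_disjointed)
  have B_D: "B i \<subseteq> D i" for i
    by (simp add: B_def disjointed_subset)
  define p where "p i = measure \<theta> (B i)" for i
  have "(\<Union>i<N. B i) = (\<Union>i<N. D i)"
    using finite_UN_disjointed_eq[of D N] by (simp add: B_def atLeast0LessThan)
  moreover have "(\<Union>i<N. D i) \<in> sets \<theta>"
    using D by (auto simp: sets_\<theta>)
  ultimately have "1 = measure \<theta> (\<Union>i<N. B i)"
    using cover prob_eq_1[of "\<Union>i<N. D i"] by simp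
  also have "\<dots> = (\<Sum>i<N. p i)"
    unfolding p_def using disj
    by (intro finite_measure_finite_Union) (auto simp: disjoint_family_on_def sets_\<theta>)
  finally have sum_p: "(\<Sum>i<N. p i) = 1" by simp
  then have N: "N > 0" by (cases N) auto
  have "1 \<le> real N * (\<Sum>i<N. (p i)\<^sup>2)"
    using sum_squared_le_sum_of_squares[of p "{..<N}"] sum_p by (simp add: mult.commute)
  then have "1 / real N \<le> (\<Sum>i<N. (p i)\<^sup>2)"
    using N by (simp add: field_simps)
  then have "ennreal (1 / real N) \<le> ennreal (\<Sum>i<N. (p i)\<^sup>2)"
    by (rule ennreal_leI)
  also have "\<dots> = (\<Sum>i<N. \<integral>\<^sup>+ x. \<integral>\<^sup>+ y. indicator (B i) x * indicator (B i) y \<partial>\<theta> \<partial>\<theta>)"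
    by (simp add: sum_ennreal[symmetric] nn_integral_cmult nn_integral_multc emeasure_eq_measure
        p_def power2_eq_square ennreal_mult)
  also have "\<dots> = (\<integral>\<^sup>+ x. \<integral>\<^sup>+ y. (\<Sum>i<N. indicator (B i) x * indicator (B i) y) \<partial>\<theta> \<partial>\<theta>)"
    by (simp add: nn_integral_sum del: sum_mult_indicator sum_indicator_mult)
  also have "\<dots> \<le> close_mass \<theta> r"
    unfolding close_mass_def
  proof (intro nn_integral_mono)
    fix x y
    show "(\<Sum>i<N. indicator (B i) x * indicator (B i) y) \<le> (indicator {..r} (norm (x - y)) :: ennreal)"
    proof (cases "\<exists>i<N. x \<in> B i \<and> y \<in> B i")
      case True
      then obtain i where i: "i < N" "x \<in> B i" "y \<in> B i" by blast
      have "indicator (B j) x * indicator (B j) y = (if j = i then 1 else 0 :: ennreal)" for j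
        using disj i by (auto simp: disjoint_family_on_def indicator_def)
      then have "(\<Sum>j<N. indicator (B j) x * indicator (B j) y) = (1 :: ennreal)"
        using i by (simp add: sum.delta)
      then show ?thesis
        using diam[of i x y] B_D i by (auto simp: indicator_def)
    next
      case False
      then have "(\<Sum>i<N. indicator (B i) x * indicator (B i) y) = (0 :: ennreal)"
        by (intro sum.neutral) (auto simp: indicator_def)
      then show ?thesis by simp
    qed
  qed
  finally show ?thesis .
qed

section \<open>Close pairs in the image of the boundary\<close>

context digit_tree
begin

text \<open>A measure of finite energy lives on a set covered by at most
  \<open>C * m ^ (n + k)\<close> cubes of diameter at most \<open>1 / b ^ n\<close>, so its close
  pairs have mass of order at least \<open>m ^ -n\<close>.\<close>

lemma summable_of_capacity_pos:
  assumes g: "gauge_function g" and m: "m > 1"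
    and growth: "\<And>n. real (card (level n)) \<le> C * m ^ n"
    and pos: "gauge_capacity g (base_expansion b ` tree_boundary A) > 0"
  shows "(\<Sum>n. ennreal (g (1 / real b ^ Suc n) / m ^ Suc n)) < \<infinity>"
proof -
  let ?L = "base_expansion b ` tree_boundary A :: (real ^ 'd) set"
  \<comment> \<open>Since \<open>inverse \<top> = 0\<close>, positive capacity means a finite
    infimum, hence an admissible measure of finite energy.\<close>
  have *: "x < \<top>" if "inverse x > 0" for x :: ennreal
    using that by (cases "x = \<top>") (auto simp: less_top[symmetric])
  have "(INF \<theta>\<in>{\<theta>. sets \<theta> = sets borel \<and> prob_space \<theta> \<and> emeasure \<theta> ?L = 1}.
       gauge_energy g \<theta>) < \<top>"
    by (rule *) (use pos in \<open>simp only: gauge_capacity_def\<close>)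
  then obtain \<theta> where sets_\<theta>: "sets \<theta> = sets borel" and "prob_space \<theta>"
    and L1: "emeasure \<theta> ?L = 1" and energy: "gauge_energy g \<theta> < \<infinity>"
    by (auto simp: INF_less_iff)
  interpret prob_space \<theta> by fact
  have AE_L: "AE x in \<theta>. x \<in> ?L"
    using L1 closed_boundary_image by (subst prob_eq_1[symmetric]) (auto simp: sets_\<theta> measure_def)
  \<comment> \<open>The image has mass 1 and is thus nonempty, so every level is inhabited and
    dividing by its size is meaningful.\<close>
  have card_pos: "card (level n) > 0" for n
  proof -
    have "?L \<noteq> {}" using L1 by auto
    then have "level n \<noteq> {}"
      unfolding boundary_image by blast
    then show ?thesis by (simp add: card_gt_0_iff)
  qed
  \<comment> \<open>Going \<open>k\<close> levels deeper absorbs the factor \<open>CARD('d)\<close>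
    in the diameter of a cube; it changes the constant only by \<open>m ^ k\<close>.\<close>
  obtain k where "real CARD('d) < real b ^ k"
    using real_arch_pow[of "real b" "real CARD('d)"] b by auto
  then have k: "real CARD('d) \<le> real b ^ k"
    by (rule less_imp_le)
  have C: "C > 0"
    using growth[of 0] card_pos[of 0] by simp
  have mass: "ennreal (1 / (C * m ^ k) / m ^ n) \<le> close_mass \<theta> (1 / real b ^ n)" for n
  proof -
    let ?N = "card (level (n + k))"
    obtain e where e: "bij_betw e {..<?N} (level (n + k))"
      using ex_bij_betw_nat_finite[OF finite_level[of "n + k"]] by (auto simp: atLeast0LessThan)
    have "ennreal (1 / real ?N) \<le> close_mass \<theta> (1 / real b ^ n)"
    proof (rule close_mass_ge_cover[OF sets_\<theta> \<open>prob_space \<theta>\<close>])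
      show "AE x in \<theta>. x \<in> (\<Union>i<?N. cell b (e i))"
        using AE_L
      proof eventually_elim
        case (elim x)
        then have "x \<in> (\<Union>v\<in>level (n + k). cell b v)"
          unfolding boundary_image by (rule INT_D) simp
        then show ?case
          using bij_betw_imp_surj_on[OF e] by (metis UN_E UN_I imageE)
      qed
      fix i and x y :: "real ^ 'd"
      assume "i < ?N" and xy: "x \<in> cell b (e i)" "y \<in> cell b (e i)"
      then have "length (e i) = n + k"
        using bij_betwE[OF e] by (simp add: level_def)
      then have "norm (x - y) \<le> real CARD('d) / real b ^ (n + k)"
        using norm_diff_cell[OF xy] b by simp
      also have "\<dots> \<le> 1 / real b ^ n"
        using k b by (simp add: power_add field_simps)
      finally show "norm (x - y) \<le> 1 / real b ^ n" .
    qed (simp add: borel_closed closed_cell)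
    have "1 / (C * m ^ k) / m ^ n = 1 / (C * m ^ (n + k))"
      by (simp add: power_add)
    also have "\<dots> \<le> 1 / real ?N"
      using growth[of "n + k"] card_pos[of "n + k"] by (intro divide_left_mono mult_pos_pos) (use C m in auto)
    finally have "ennreal (1 / (C * m ^ k) / m ^ n) \<le> ennreal (1 / real ?N)"
      by (rule ennreal_leI)
    also note \<open>\<dots> \<le> close_mass \<theta> (1 / real b ^ n)\<close>
    finally show ?thesis .
  qed
  show ?thesis
    by (rule summable_of_finite_energy[OF g b sets_\<theta> \<open>prob_space \<theta>\<close> m _ mass energy])
      (use C m in simp)
qed

text \<open>The bound 2 comes from points at distance at most one side length: after rescaling they
  differ by at most 1 in each coordinate, and each exceeds its corner by at most 1.\<close>

definition near :: "(nat ^ 'd) list \<Rightarrow> (nat ^ 'd) list \<Rightarrow> bool" where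
  "near v v' \<longleftrightarrow> (\<forall>i. \<bar>int (corner b v $ i) - int (corner b v' $ i)\<bar> \<le> 2)"

lemma near_sym: "near v v' \<longleftrightarrow> near v' v"
  by (auto simp: near_def abs_minus_commute)

text \<open>Each coordinate allows the five differences from -2 to 2, and a word of given length is
  determined by its corner.\<close>

lemma card_near_le: "card {v' \<in> level n. near v v'} \<le> 5 ^ CARD('d)"
proof -
  let ?f = "\<lambda>v' i. int (corner b v' $ i) - int (corner b v $ i)"
  have "inj_on ?f {v' \<in> level n. near v v'}"
  proof (rule inj_onI)
    fix x y assume xy: "x \<in> {v' \<in> level n. near v v'}" "y \<in> {v' \<in> level n. near v v'}" "?f x = ?f y"
    then have "corner b x = corner b y"
      by (auto simp: vec_eq_iff fun_eq_iff)
    then show "x = y"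
      using xy words by (intro corner_inj[of x y b]) (auto simp: level_def)
  qed
  moreover have "?f ` {v' \<in> level n. near v v'} \<subseteq> PiE UNIV (\<lambda>_::'d. {-2..2})"
    by (rule image_subsetI) (force simp: near_def abs_le_iff)
  moreover have "finite (PiE UNIV (\<lambda>_::'d. {-2..2::int}))"
    by (simp add: finite_PiE)
  ultimately have "card {v' \<in> level n. near v v'} \<le> card (PiE UNIV (\<lambda>_::'d. {-2..2::int}))"
    by (rule card_inj_on_le)
  then show ?thesis
    by (simp add: card_PiE)
qed

lemma nearI:
  fixes x y :: "real ^ 'd"
  assumes "x \<in> cell b v" "y \<in> cell b v'" "length v = n" "length v' = n"
    and xy: "norm (x - y) \<le> 1 / real b ^ n"
  shows "near v v'"
  unfolding near_def
proof
  fix i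
  have "\<bar>(x - y) $ i\<bar> \<le> 1 / real b ^ n"
    using component_le_norm_cart[of "x - y" i] xy by linarith
  then have "real b ^ n * \<bar>x $ i - y $ i\<bar> \<le> 1"
    using b by (simp add: field_simps)
  then have "\<bar>real b ^ n * x $ i - real b ^ n * y $ i\<bar> \<le> 1"
    by (simp add: abs_mult flip: right_diff_distrib)
  moreover have "real (corner b v $ i) \<le> real b ^ n * x $ i"
    "real b ^ n * x $ i \<le> real (corner b v $ i) + 1"
    "real (corner b v' $ i) \<le> real b ^ n * y $ i"
    "real b ^ n * y $ i \<le> real (corner b v' $ i) + 1"
    using assms by (auto simp: cell_def)
  ultimately show "\<bar>int (corner b v $ i) - int (corner b v' $ i)\<bar> \<le> 2"
    by linarith
qed

text \<open>By \<open>2 p p' \<le> p\<^sup>2 + p'\<^sup>2\<close> and the symmetry of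
  \<open>near\<close>, the double sum is at most the sum of squares times the maximal number of
  neighbours.\<close>

lemma sum_near_le:
  fixes p :: "(nat ^ 'd) list \<Rightarrow> real"
  shows "(\<Sum>v\<in>level n. \<Sum>v'\<in>{v' \<in> level n. near v v'}. p v * p v') \<le> 5 ^ CARD('d) * (\<Sum>v\<in>level n. (p v)\<^sup>2)"
proof -
  let ?S = "\<Sum>v\<in>level n. \<Sum>v'\<in>{v' \<in> level n. near v v'}. (p v)\<^sup>2"
  have swap: "(\<Sum>v\<in>level n. \<Sum>v'\<in>{v' \<in> level n. near v v'}. (p v')\<^sup>2) = ?S"
    using sum.swap_restrict[OF finite_level[of n] finite_level[of n], of "\<lambda>v v'. (p v')\<^sup>2" near]
    by (simp add: near_sym)
  have "(\<Sum>v\<in>level n. \<Sum>v'\<in>{v' \<in> level n. near v v'}. p v * p v')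
      \<le> (\<Sum>v\<in>level n. \<Sum>v'\<in>{v' \<in> level n. near v v'}. (p v)\<^sup>2 / 2 + (p v')\<^sup>2 / 2)"
    using sum_squares_bound[of "p _" "p _"] by (intro sum_mono) (simp add: field_simps)
  also have "\<dots> = ?S"
    by (simp only: sum.distrib sum_divide_distrib[symmetric] swap)
  also have "\<dots> \<le> (\<Sum>v\<in>level n. 5 ^ CARD('d) * (p v)\<^sup>2)"
    using of_nat_mono[OF card_near_le[of n], where 'a = real]
    by (intro sum_mono) (simp add: mult_right_mono)
  finally show ?thesis
    by (simp add: sum_distrib_left)
qed

end

section \<open>The measure carried by a flow\<close>

locale tree_flow = digit_tree b A for b :: nat and A :: "(nat ^ 'd) list set" +
  fixes \<mu> :: "(nat ^ 'd) list \<Rightarrow> real"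
  assumes flow_pos: "v \<in> A \<Longrightarrow> \<mu> v > 0"
    and flow_root: "\<mu> [] = 1"
    and flow_split: "v \<in> A \<Longrightarrow> \<mu> v = (\<Sum>w\<in>{w \<in> digits b. v @ [w] \<in> A}. \<mu> (v @ [w]))"
begin

text \<open>The conditional law of the next digit of a random ray at \<open>v\<close>. Off
  \<open>A\<close> a point mass completes the definition, so that a product over all words can be
  formed.\<close>

definition step_pmf :: "(nat ^ 'd) list \<Rightarrow> (nat ^ 'd) pmf" where
  "step_pmf v = (if v \<in> A then embed_pmf (\<lambda>w. if v @ [w] \<in> A then \<mu> (v @ [w]) / \<mu> v else 0)
     else return_pmf 0)"

lemma pmf_step:
  assumes v: "v \<in> A"
  shows "pmf (step_pmf v) w = (if v @ [w] \<in> A then \<mu> (v @ [w]) / \<mu> v else 0)"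
proof -
  let ?f = "\<lambda>w. if v @ [w] \<in> A then \<mu> (v @ [w]) / \<mu> v else 0"
  have child: "w \<in> digits b" if "v @ [w] \<in> A" for w
    using that words by auto
  have nn: "0 \<le> ?f w" for w
    using flow_pos v by (simp add: less_imp_le)
  have "(\<integral>\<^sup>+ w. ennreal (?f w) \<partial>count_space UNIV) = (\<Sum>w\<in>digits b. ennreal (?f w))"
    using child by (intro nn_integral_count_space') auto
  also have "\<dots> = ennreal (\<Sum>w\<in>digits b. ?f w)"
    using nn by (intro sum_ennreal) auto
  also have "(\<Sum>w\<in>digits b. ?f w) = (\<Sum>w\<in>{w \<in> digits b. v @ [w] \<in> A}. \<mu> (v @ [w]) / \<mu> v)"
    by (simp add: sum.inter_filter)
  also have "\<dots> = 1"
    using flow_split[OF v] flow_pos[OF v] by (simp flip: sum_divide_distrib)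
  finally show ?thesis
    using v nn by (simp add: step_pmf_def pmf_embed_pmf)
qed

text \<open>The measure on rays with prescribed cylinder masses is obtained from a product measure:
  every word draws a next digit independently, and \<open>path\<close> follows these draws from the
  root.\<close>

definition choices :: "((nat ^ 'd) list \<Rightarrow> nat ^ 'd) measure" where
  "choices = (\<Pi>\<^sub>M v\<in>UNIV. measure_pmf (step_pmf v))"

sublocale choices: prob_space choices
  unfolding choices_def by (intro prob_space_PiM prob_space_measure_pmf)

lemma space_choices [simp]: "space choices = UNIV"
  by (simp add: choices_def space_PiM PiE_UNIV_domain)

primrec path :: "((nat ^ 'd) list \<Rightarrow> nat ^ 'd) \<Rightarrow> nat \<Rightarrow> (nat ^ 'd) list" where
  "path J 0 = []"
| "path J (Suc n) = path J n @ [J (path J n)]"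

definition path_limit :: "((nat ^ 'd) list \<Rightarrow> nat ^ 'd) \<Rightarrow> real ^ 'd" where
  "path_limit J = base_expansion b (\<lambda>n. J (path J n))"

lemma length_path [simp]: "length (path J n) = n"
  by (induction n) auto

lemma path_eq_map: "path J n = map (\<lambda>n. J (path J n)) [0..<n]"
  by (induction n) auto

lemma measurable_choice [measurable]: "(\<lambda>J. J v) \<in> measurable choices (count_space UNIV)"
  unfolding choices_def
  using measurable_component_singleton[of v UNIV "\<lambda>v. measure_pmf (step_pmf v)"] by simp

lemma measurable_path [measurable]: "(\<lambda>J. path J n) \<in> measurable choices (count_space UNIV)"
proof (induction n)
  case (Suc n)
  note Suc [measurable]
  have "(\<lambda>J. v @ [J v]) \<in> measurable choices (count_space UNIV)" for v
    by measurable
  then have "(\<lambda>J. path J n @ [J (path J n)]) \<in> measurable choices (count_space UNIV)"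
    by (rule measurable_compose_countable[where f = "\<lambda>v J. v @ [J v]", OF _ Suc])
  then show ?case by simp
qed simp

lemma measurable_path_choice [measurable]:
  "(\<lambda>J. J (path J n)) \<in> measurable choices (count_space UNIV)"
  by (rule measurable_compose_countable[where f = "\<lambda>v J. J v"]) measurable

lemma measurable_path_limit [measurable]: "path_limit \<in> borel_measurable choices"
  unfolding path_limit_def[abs_def] base_expansion_def[abs_def]
proof (rule borel_measurable_suminf)
  fix n
  have "(\<lambda>w. (1 / real b ^ Suc n) *\<^sub>R (\<chi> i. real (w $ i)) :: real ^ 'd)
      \<in> borel_measurable (count_space UNIV)"
    by simp
  from measurable_compose[OF measurable_path_choice this]
  show "(\<lambda>J. (1 / real b ^ Suc n) *\<^sub>R (\<chi> i. real (J (path J n) $ i)) :: real ^ 'd)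
      \<in> borel_measurable choices" .
qed

lemma AE_path: "AE J in choices. \<forall>n. path J n \<in> A"
proof -
  have "AE J in choices. \<forall>v. v \<in> A \<longrightarrow> v @ [J v] \<in> A"
  proof (subst AE_all_countable, intro allI)
    fix v
    show "AE J in choices. v \<in> A \<longrightarrow> v @ [J v] \<in> A"
      unfolding choices_def
    proof (rule AE_PiM_component)
      show "AE w in measure_pmf (step_pmf v). v \<in> A \<longrightarrow> v @ [w] \<in> A"
        by (auto simp: AE_measure_pmf_iff set_pmf_eq pmf_step)
    qed (auto intro: prob_space_measure_pmf)
  qed
  then show ?thesis
  proof eventually_elim
    case (elim J)
    have "path J n \<in> A" for n
      by (induction n) (use elim root in auto)
    then show ?case ..
  qed
qed

text \<open>Passing through \<open>v\<close> depends only on the draws at the proper prefixes of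
  \<open>v\<close>, so the event is a finite-dimensional cylinder.\<close>

lemma path_eq_iff: "path J (length v) = v \<longleftrightarrow> (\<forall>i<length v. J (take i v) = v ! i)"
proof (induction v rule: rev_induct)
  case (snoc w v)
  have "path J (length (v @ [w])) = v @ [w] \<longleftrightarrow> path J (length v) = v \<and> J v = w"
    by auto
  also have "\<dots> \<longleftrightarrow> (\<forall>i<length (v @ [w]). J (take i (v @ [w])) = (v @ [w]) ! i)"
    unfolding snoc.IH by (auto simp: nth_append less_Suc_eq)
  finally show ?case .
qed simp

text \<open>The conditional probabilities along the prefixes of \<open>v\<close> telescope.\<close>

lemma prob_path:
  assumes v: "v \<in> A"
  shows "emeasure choices {J. path J (length v) = v} = ennreal (\<mu> v)"
proof -
  let ?P = "(\<lambda>i. take i v) ` {..<length v}"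
  let ?X = "\<lambda>u. {v ! length u}"
  \<comment> \<open>Prefixes of different lengths are distinct, so the product over prefixes can be
    indexed by length.\<close>
  have inj: "inj_on (\<lambda>i. take i v) {..<length v}"
    by (rule inj_onI) (metis lessThan_iff length_take min.absorb4)
  have "{J. path J (length v) = v} = prod_emb UNIV (\<lambda>v. measure_pmf (step_pmf v)) ?P (Pi\<^sub>E ?P ?X)"
    unfolding path_eq_iff by (auto simp: prod_emb_def PiE_UNIV_domain restrict_PiE_iff Pi_iff)
  then have "emeasure choices {J. path J (length v) = v}
      = (\<Prod>u\<in>?P. emeasure (measure_pmf (step_pmf u)) (?X u))"
    unfolding choices_def
    by (simp only:) (rule emeasure_PiM_emb, auto intro: prob_space_measure_pmf)
  also have "\<dots> = (\<Prod>i<length v. ennreal (pmf (step_pmf (take i v)) (v ! i)))"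
    by (simp add: prod.reindex[OF inj] emeasure_pmf_single)
  also have "\<dots> = (\<Prod>i<length v. ennreal (\<mu> (take (Suc i) v) / \<mu> (take i v)))"
  proof (intro prod.cong refl arg_cong[of _ _ ennreal])
    fix i assume i: "i \<in> {..<length v}"
    then have eq: "take i v @ [v ! i] = take (Suc i) v"
      by (simp add: take_Suc_conv_app_nth)
    have "take k v \<in> A" for k
      using prefix_in[of "take k v" "drop k v"] v by simp
    then show "pmf (step_pmf (take i v)) (v ! i) = \<mu> (take (Suc i) v) / \<mu> (take i v)"
      by (simp add: pmf_step eq)
  qed
  also have "\<dots> = ennreal (\<mu> v)"
  proof -
    have pos: "\<mu> (take k v) > 0" for k
      using prefix_in[of "take k v" "drop k v"] v flow_pos by simp
    have "(\<Prod>i<k. ennreal (\<mu> (take (Suc i) v) / \<mu> (take i v))) = ennreal (\<mu> (take k v))" for k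
    proof (induction k)
      case (Suc k)
      have "(\<Prod>i<Suc k. ennreal (\<mu> (take (Suc i) v) / \<mu> (take i v)))
          = ennreal (\<mu> (take k v)) * ennreal (\<mu> (take (Suc k) v) / \<mu> (take k v))"
        using Suc by simp
      also have "\<dots> = ennreal (\<mu> (take (Suc k) v))"
        using pos[of k] pos[of "Suc k"] by (simp add: ennreal_mult'[symmetric])
      finally show ?case .
    qed (simp add: flow_root)
    from this[of "length v"] show ?thesis by simp
  qed
  finally show ?thesis .
qed

lemma path_limit_in:
  assumes "\<forall>n. path J n \<in> A"
  shows "path J n \<in> level n" "path_limit J \<in> cell b (path J n)"
    "path_limit J \<in> base_expansion b ` tree_boundary A"
proof -
  let ?\<omega> = "\<lambda>n. J (path J n)"
  have \<omega>: "?\<omega> \<in> tree_boundary A"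
    using assms by (simp add: tree_boundary_def flip: path_eq_map)
  show "path J n \<in> level n"
    using assms by (simp add: level_def)
  show "path_limit J \<in> cell b (path J n)"
    unfolding path_limit_def by (subst path_eq_map) (rule base_expansion_in_cell[OF b digits_boundary[OF \<omega>]])
  show "path_limit J \<in> base_expansion b ` tree_boundary A"
    unfolding path_limit_def by (rule imageI[OF \<omega>])
qed

text \<open>Two independent random rays with limits within \<open>1 / b ^ n\<close> pass through
  \<open>near\<close> vertices of level \<open>n\<close>. Independence gives each pair of vertices
  the mass \<open>\<mu> v * \<mu> v'\<close>, and \<open>sum_near_le\<close> reduces to
  squares.\<close>

lemma close_mass_path_limit_le:
  "close_mass (distr choices borel path_limit) (1 / real b ^ n)
    \<le> ennreal (5 ^ CARD('d) * (\<Sum>v\<in>level n. (\<mu> v)\<^sup>2))"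
proof -
  define E where "E v = {J. path J n = v}" for v
  have E_eq: "E v = (\<lambda>J. path J n) -` {v} \<inter> space choices" for v
    by (auto simp: E_def)
  have E [measurable]: "E v \<in> sets choices" for v
    unfolding E_eq by (rule measurable_sets[OF measurable_path]) simp
  have emeasure_E: "emeasure choices (E v) = ennreal (\<mu> v)" if "v \<in> level n" for v
    using that prob_path[of v] by (auto simp: level_def E_def)
  have "close_mass (distr choices borel path_limit) (1 / real b ^ n)
      = (\<integral>\<^sup>+ J. \<integral>\<^sup>+ J'. indicator {..1 / real b ^ n} (norm (path_limit J - path_limit J')) \<partial>choices \<partial>choices)"
    by (simp add: close_mass_def nn_integral_distr)
  also have "\<dots> \<le> (\<integral>\<^sup>+ J. \<integral>\<^sup>+ J'. (\<Sum>v\<in>level n. \<Sum>v'\<in>{v' \<in> level n. near v v'}.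
      indicator (E v) J * indicator (E v') J') \<partial>choices \<partial>choices)"
    using AE_path
  proof (intro nn_integral_mono_AE, eventually_elim)
    fix J assume J: "\<forall>n. path J n \<in> A"
    show "(\<integral>\<^sup>+ J'. indicator {..1 / real b ^ n} (norm (path_limit J - path_limit J')) \<partial>choices)
        \<le> (\<integral>\<^sup>+ J'. (\<Sum>v\<in>level n. \<Sum>v'\<in>{v' \<in> level n. near v v'}.
      indicator (E v) J * indicator (E v') J') \<partial>choices)"
      using AE_path
    proof (intro nn_integral_mono_AE, eventually_elim)
      fix J' assume J': "\<forall>n. path J' n \<in> A"
      show "indicator {..1 / real b ^ n} (norm (path_limit J - path_limit J'))
        \<le> (\<Sum>v\<in>level n. \<Sum>v'\<in>{v' \<in> level n. near v v'}. indicator (E v) J * indicator (E v') J' :: ennreal)"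
      proof (cases "norm (path_limit J - path_limit J') \<le> 1 / real b ^ n")
        case True
        let ?v = "path J n" and ?v' = "path J' n"
        have near: "near ?v ?v'"
          using nearI[OF path_limit_in(2)[OF J] path_limit_in(2)[OF J'] _ _ True] by simp
        have "1 = (indicator (E ?v) J * indicator (E ?v') J' :: ennreal)"
          by (simp add: E_def)
        also have "\<dots> \<le> (\<Sum>v'\<in>{v' \<in> level n. near ?v v'}. indicator (E ?v) J * indicator (E v') J')"
          using near path_limit_in(1)[OF J', of n] by (intro member_le_sum) auto
        also have "\<dots> \<le> (\<Sum>v\<in>level n. \<Sum>v'\<in>{v' \<in> level n. near v v'}. indicator (E v) J * indicator (E v') J')"
          using path_limit_in(1)[OF J, of n] by (intro member_le_sum) auto
        finally show ?thesis
          using True by (simp del: sum_mult_indicator sum_indicator_mult)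
      qed simp
    qed
  qed
  also have "\<dots> = (\<Sum>v\<in>level n. \<Sum>v'\<in>{v' \<in> level n. near v v'}. ennreal (\<mu> v * \<mu> v'))"
  proof -
    have "(\<integral>\<^sup>+ J. \<integral>\<^sup>+ J'. (\<Sum>v\<in>level n. \<Sum>v'\<in>{v' \<in> level n. near v v'}.
      indicator (E v) J * indicator (E v') J') \<partial>choices \<partial>choices)
      = (\<Sum>v\<in>level n. \<Sum>v'\<in>{v' \<in> level n. near v v'}. emeasure choices (E v) * emeasure choices (E v'))"
      by (simp add: nn_integral_sum nn_integral_cmult nn_integral_multc del: sum_mult_indicator sum_indicator_mult)
    also have "\<dots> = (\<Sum>v\<in>level n. \<Sum>v'\<in>{v' \<in> level n. near v v'}. ennreal (\<mu> v * \<mu> v'))"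
      using flow_pos by (intro sum.cong refl) (simp add: emeasure_E level_def ennreal_mult less_imp_le)
    finally show ?thesis .
  qed
  also have "\<dots> = ennreal (\<Sum>v\<in>level n. \<Sum>v'\<in>{v' \<in> level n. near v v'}. \<mu> v * \<mu> v')"
  proof -
    have "0 \<le> \<mu> v * \<mu> v'" if "v \<in> level n" "v' \<in> level n" for v v'
      using that flow_pos[of v] flow_pos[of v'] by (simp add: level_def)
    then show ?thesis
      by (subst sum_ennreal[symmetric])
        (auto intro!: sum_nonneg sum.cong sum_ennreal simp del: sum_ennreal)
  qed
  also have "\<dots> \<le> ennreal (5 ^ CARD('d) * (\<Sum>v\<in>level n. (\<mu> v)\<^sup>2))"
    by (intro ennreal_leI sum_near_le)
  finally show ?thesis .
qed

text \<open>The law of \<open>path_limit\<close> is carried by the image of the boundary and has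
  finite energy, so it bounds the infimum in the capacity.\<close>

lemma capacity_pos_of_summable:
  assumes g: "gauge_function g" and m: "m > 1"
    and square: "\<And>n. (\<Sum>v\<in>level n. (\<mu> v)\<^sup>2) \<le> C / m ^ n"
    and fin: "(\<Sum>n. ennreal (g (1 / real b ^ Suc n) / m ^ Suc n)) < \<infinity>"
  shows "gauge_capacity g (base_expansion b ` tree_boundary A) > 0"
proof -
  let ?L = "base_expansion b ` tree_boundary A :: (real ^ 'd) set"
  let ?\<theta> = "distr choices borel path_limit"
  have prob: "prob_space ?\<theta>"
    by (intro choices.prob_space_distr measurable_path_limit)
  have mass: "close_mass ?\<theta> (1 / real b ^ n) \<le> ennreal (5 ^ CARD('d) * C / m ^ n)" for n
    by (rule order.trans[OF close_mass_path_limit_le])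
      (use square[of n] in \<open>auto intro!: ennreal_leI simp flip: times_divide_eq_right\<close>)
  have energy: "gauge_energy g ?\<theta> < \<infinity>"
    by (rule finite_energy_of_summable[OF g b _ prob m mass fin]) simp
  have "AE J in choices. path_limit J \<in> ?L"
    using AE_path by eventually_elim (rule path_limit_in(3))
  then have "emeasure choices (path_limit -` ?L \<inter> space choices) = 1"
    using measurable_sets[OF measurable_path_limit borel_closed[OF closed_boundary_image]]
    by (subst choices.emeasure_eq_1_AE) auto
  then have "emeasure ?\<theta> ?L = 1"
    using closed_boundary_image by (subst emeasure_distr) (auto intro!: borel_closed)
  with prob have "(INF \<theta>\<in>{\<theta>. sets \<theta> = sets borel \<and> prob_space \<theta> \<and> emeasure \<theta> ?L = 1}.
       gauge_energy g \<theta>) \<le> gauge_energy g ?\<theta>"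
    by (intro INF_lower) simp
  also note energy
  finally have INF: "(INF \<theta>\<in>{\<theta>. sets \<theta> = sets borel \<and> prob_space \<theta> \<and> emeasure \<theta> ?L = 1}.
       gauge_energy g \<theta>) < \<infinity>" .
  have "inverse x > 0" if "x < \<infinity>" for x :: ennreal
    using that by (simp add: ennreal_inverse_positive)
  from this[OF INF] show ?thesis
    by (simp only: gauge_capacity_def)
qed

end

section \<open>Sums over a generation of a Galton-Watson tree\<close>

definition subcounts :: "nat list \<Rightarrow> (nat list \<Rightarrow> nat) \<Rightarrow> nat list \<Rightarrow> nat" where
  "subcounts v K = (\<lambda>u. K (v @ u))"

text \<open>The sum of \<open>Y\<close> over the subtrees rooted at generation \<open>n\<close>.
  Recursing at the root makes the branching property directly applicable.\<close>

primrec gen_sum :: "((nat list \<Rightarrow> nat) \<Rightarrow> real) \<Rightarrow> nat \<Rightarrow> (nat list \<Rightarrow> nat) \<Rightarrow> real" where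
  "gen_sum Y 0 K = Y K"
| "gen_sum Y (Suc n) K = (\<Sum>i<K []. gen_sum Y n (subcounts [i] K))"

lemma subcounts_apply: "subcounts v K u = K (v @ u)"
  by (simp add: subcounts_def)

lemma subcounts_Nil [simp]: "subcounts [] K = K"
  by (simp add: subcounts_def)

lemma subcounts_subcounts [simp]: "subcounts u (subcounts v K) = subcounts (v @ u) K"
  by (simp add: subcounts_def)

text \<open>The definition peels off the first generation, this identity the last; it expresses one
  step of population growth as a sum over the previous generation.\<close>

lemma gen_sum_Suc': "gen_sum Y (Suc n) K = gen_sum (\<lambda>K. \<Sum>i<K []. Y (subcounts [i] K)) n K"
proof (induction n arbitrary: K)
  case (Suc n)
  show ?case
    by (subst gen_sum.simps(2), subst Suc) simp
qed simp

lemma gen_sum_diff: "gen_sum (\<lambda>K. Y K - c * Z K) n K = gen_sum Y n K - c * gen_sum Z n K"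
  by (induction n arbitrary: K) (simp_all add: sum_subtractf sum_distrib_left)

lemma gen_sum_nonneg: "(\<And>K. Y K \<ge> 0) \<Longrightarrow> gen_sum Y n K \<ge> 0"
  by (induction n arbitrary: K) (simp_all add: sum_nonneg)

locale offspring =
  fixes q :: "nat pmf" and B :: nat and m :: real
  assumes q0: "pmf q 0 = 0" and q1: "pmf q 1 \<noteq> 1" and q_bound: "\<And>i. i > B \<Longrightarrow> pmf q i = 0"
    and m_def: "m = (\<Sum>n. real n * pmf q n)"
begin

lemma set_q: "set_pmf q \<subseteq> {..B}"
  using q_bound by (auto simp: set_pmf_eq not_le[symmetric])

lemma expectation_q: "measure_pmf.expectation q f = (\<Sum>k\<le>B. f k * pmf q k)" for f :: "nat \<Rightarrow> real"
  using set_q by (intro integral_measure_pmf_real) auto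

lemma sum_q: "(\<Sum>k\<le>B. pmf q k) = 1"
  using expectation_q[of "\<lambda>_. 1"] by simp

lemma m_eq: "m = (\<Sum>k\<le>B. real k * pmf q k)"
  unfolding m_def using q_bound by (intro suminf_finite) (auto simp: not_le)

text \<open>\<open>m - 1\<close> is the sum of \<open>(k - 1) * pmf q k\<close>. No term is negative
  because \<open>pmf q 0 = 0\<close>, and \<open>pmf q 1 \<noteq> 1\<close> makes one term
  positive.\<close>

lemma m_gt_1: "m > 1"
proof -
  have "m - 1 = (\<Sum>k\<le>B. (real k - 1) * pmf q k)"
    using sum_q by (simp add: m_eq left_diff_distrib sum_subtractf)
  moreover have "(\<Sum>k\<le>B. (real k - 1) * pmf q k) > 0"
  proof -
    have nn: "(real k - 1) * pmf q k \<ge> 0" for k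
      using q0 by (cases k) auto
    have "\<exists>k\<le>B. k \<noteq> 1 \<and> pmf q k > 0"
    proof (rule ccontr)
      assume "\<not> ?thesis"
      then have *: "pmf q k = 0" if "k \<noteq> 1" for k
        using that q_bound[of k] by (cases "k \<le> B") (auto simp: pmf_nonneg not_less order.antisym)
      have "(\<Sum>k\<le>B. pmf q k) = (\<Sum>k\<le>B. if k = 1 then pmf q 1 else 0)"
        using * by (intro sum.cong) auto
      also have "\<dots> \<in> {0, pmf q 1}" by (simp add: sum.delta)
      finally show False using sum_q q1 by auto
    qed
    then obtain k where k: "k \<le> B" "k \<noteq> 1" "pmf q k > 0" by blast
    then have "k \<ge> 2"
      using q0 by (cases k) auto
    then have "(real k - 1) * pmf q k > 0" using k by simp
    then show ?thesis
      using k nn by (intro sum_pos2[of _ k]) auto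
  qed
  ultimately show ?thesis by simp
qed

text \<open>The tail formula for the mean, in the form that arises when a sum over
  \<open>i < K []\<close> is written over the fixed range \<open>i < B\<close> with
  indicators.\<close>

lemma sum_prob_less: "(\<Sum>i<B. measure_pmf.prob q {k. i < k}) = m"
proof -
  have "measure_pmf.prob q {k. i < k} = (\<Sum>k\<le>B. indicator {k. i < k} k * pmf q k)" for i
    using expectation_q[of "indicator {k. i < k}"] by simp
  then have "(\<Sum>i<B. measure_pmf.prob q {k. i < k})
      = (\<Sum>k\<le>B. (\<Sum>i<B. indicator {k. i < k} k) * pmf q k)"
    by (simp only: sum_distrib_right) (rule sum.swap)
  also have "\<dots> = m"
    unfolding m_eq
  proof (intro sum.cong refl arg_cong2[of _ _ _ _ times])
    fix k assume "k \<in> {..B}"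
    then have "{i. i < B \<and> i < k} = {..<k}" by auto
    then show "(\<Sum>i<B. indicator {k. i < k} k) = real k"
      by (simp add: indicator_def sum.If_cases Int_def)
  qed
  finally show ?thesis .
qed

section \<open>The product measure of child counts and the branching property\<close>

definition counts :: "(nat list \<Rightarrow> nat) measure" where
  "counts = (\<Pi>\<^sub>M v\<in>UNIV. measure_pmf q)"

sublocale counts: prob_space counts
  unfolding counts_def by (intro prob_space_PiM prob_space_measure_pmf)

lemma space_counts [simp]: "space counts = UNIV"
  by (simp add: counts_def space_PiM PiE_UNIV_domain)

lemma measurable_count [measurable]: "(\<lambda>K. K v) \<in> measurable counts (count_space UNIV)"
  unfolding counts_def
  using measurable_component_singleton[of v UNIV "\<lambda>_. measure_pmf q"] by simp

lemma distr_count: "distr counts (measure_pmf q) (\<lambda>K. K v) = measure_pmf q"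
  unfolding counts_def by (rule distr_PiM_component) (auto intro: prob_space_measure_pmf)

lemma measurable_into_counts:
  assumes "\<And>v. (\<lambda>x. f x v) \<in> measurable M (count_space UNIV)"
  shows "f \<in> measurable M counts"
  unfolding counts_def by (rule measurable_PiM_single') (use assms in auto)

lemma measurable_subcounts [measurable]: "subcounts v \<in> measurable counts counts"
  by (rule measurable_into_counts) (simp add: subcounts_apply)

text \<open>Each subtree has the law of the whole tree: \<open>u \<mapsto> v @ u\<close> is
  injective, and reindexing a product of equal factors along an injection preserves its law.\<close>

lemma distr_subcounts: "distr counts counts (subcounts v) = counts"
  using distr_PiM_reindex[of UNIV "\<lambda>_. measure_pmf q" "(@) v" UNIV]
  by (simp add: counts_def subcounts_def[abs_def] prob_space_measure_pmf inj_on_def restrict_def)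

lemma AE_subcounts:
  assumes "AE K in counts. P K"
  shows "AE K in counts. P (subcounts v K)"
proof (rule AE_distrD[OF measurable_subcounts])
  show "AE K in distr counts counts (subcounts v). P K"
    unfolding distr_subcounts by (rule assms)
qed

lemma nn_integral_subcounts:
  "f \<in> borel_measurable counts \<Longrightarrow> (\<integral>\<^sup>+ K. f (subcounts v K) \<partial>counts) = (\<integral>\<^sup>+ K. f K \<partial>counts)"
  using nn_integral_distr[OF measurable_subcounts[of v], where f = f] by (simp add: distr_subcounts)

lemma integral_subcounts:
  fixes f :: "_ \<Rightarrow> real"
  shows "f \<in> borel_measurable counts \<Longrightarrow> (\<integral> K. f (subcounts v K) \<partial>counts) = (\<integral> K. f K \<partial>counts)"
  using integral_distr[OF measurable_subcounts[of v], where f = f] by (simp add: distr_subcounts)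

lemma integrable_subcounts:
  fixes f :: "_ \<Rightarrow> real"
  shows "integrable counts f \<Longrightarrow> integrable counts (\<lambda>K. f (subcounts v K))"
  using integrable_distr[OF measurable_subcounts[of v], where f = f] by (simp add: distr_subcounts)

lemma AE_count_le: "AE K in counts. \<forall>v. K v \<le> B"
proof (subst AE_all_countable, intro allI)
  fix v
  show "AE K in counts. K v \<le> B"
    unfolding counts_def
    by (rule AE_PiM_component) (use set_q in \<open>auto simp: AE_measure_pmf_iff prob_space_measure_pmf\<close>)
qed

lemma indep_counts: "counts.indep_vars (\<lambda>_. measure_pmf q) (\<lambda>v K. K v) UNIV"
proof (subst counts.indep_vars_iff_distr_eq_PiM)
  show "distr counts (\<Pi>\<^sub>M i\<in>UNIV. measure_pmf q) (\<lambda>K. \<lambda>i\<in>UNIV. K i)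
      = (\<Pi>\<^sub>M i\<in>UNIV. distr counts (measure_pmf q) (\<lambda>K. K i))"
    by (simp add: distr_count) (simp add: counts_def distr_id2 restrict_def)
qed (auto simp: measurable_count)

text \<open>The branching property. \<open>None\<close> stands for the root and
  \<open>Some i\<close> for the potential subtree at child \<open>i\<close>, whether or not
  \<open>i < K []\<close>; they read disjoint sets of coordinates.\<close>

lemma indep_root_subcounts:
  fixes \<phi> :: "nat \<Rightarrow> real" and G :: "nat \<Rightarrow> (nat list \<Rightarrow> nat) \<Rightarrow> real"
  assumes G: "\<And>i. G i \<in> borel_measurable counts"
  shows "counts.indep_vars (\<lambda>_. borel)
    (\<lambda>j K. case j of None \<Rightarrow> \<phi> (K []) | Some i \<Rightarrow> G i (subcounts [i] K)) UNIV"
proof -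
  define D :: "nat option \<Rightarrow> nat list set" where
    "D j = (case j of None \<Rightarrow> {[]} | Some i \<Rightarrow> range ((#) i))" for j
  define Y :: "nat option \<Rightarrow> (nat list \<Rightarrow> nat) \<Rightarrow> real" where
    "Y j f = (case j of None \<Rightarrow> \<phi> (f []) | Some i \<Rightarrow> G i (\<lambda>u. f (i # u)))" for j f
  have "counts.indep_vars (\<lambda>j. PiM (D j) (\<lambda>_. measure_pmf q)) (\<lambda>j K. restrict (\<lambda>v. K v) (D j)) UNIV"
    by (rule counts.indep_vars_restrict[OF indep_counts])
      (auto simp: D_def disjoint_family_on_def split: option.splits)
  then have "counts.indep_vars (\<lambda>_. borel) (\<lambda>j K. Y j (restrict (\<lambda>v. K v) (D j))) UNIV"
  proof (rule counts.indep_vars_compose2)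
    fix j :: "nat option"
    show "Y j \<in> borel_measurable (PiM (D j) (\<lambda>_. measure_pmf q))"
    proof (cases j)
      case None
      have "(\<lambda>f. f []) \<in> measurable (PiM (D j) (\<lambda>_. measure_pmf q)) (measure_pmf q)"
        by (rule measurable_component_singleton) (simp add: D_def None)
      then have "(\<lambda>f. \<phi> (f [])) \<in> borel_measurable (PiM (D j) (\<lambda>_. measure_pmf q))"
        by (rule measurable_compose) simp
      then show ?thesis by (simp add: Y_def[abs_def] None)
    next
      case (Some i)
      have "(\<lambda>f. f (i # u)) \<in> measurable (PiM (D j) (\<lambda>_. measure_pmf q)) (measure_pmf q)" for u
        by (rule measurable_component_singleton) (simp add: D_def Some)
      then have "(\<lambda>f u. f (i # u)) \<in> measurable (PiM (D j) (\<lambda>_. measure_pmf q)) counts"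
        by (intro measurable_into_counts) simp
      then have "(\<lambda>f. G i (\<lambda>u. f (i # u))) \<in> borel_measurable (PiM (D j) (\<lambda>_. measure_pmf q))"
        using G by (rule measurable_compose)
      then show ?thesis by (simp add: Y_def[abs_def] Some)
    qed
  qed
  also have "(\<lambda>j K. Y j (restrict (\<lambda>v. K v) (D j)))
      = (\<lambda>j K. case j of None \<Rightarrow> \<phi> (K []) | Some i \<Rightarrow> G i (subcounts [i] K))"
    by (auto simp: fun_eq_iff Y_def D_def subcounts_def split: option.splits)
  finally show ?thesis .
qed

lemma nn_integral_count: "(\<integral>\<^sup>+ K. f (K v) \<partial>counts) = (\<integral>\<^sup>+ k. f k \<partial>measure_pmf q)"
  using nn_integral_distr[of "\<lambda>K. K v" counts "measure_pmf q" f] by (simp add: distr_count)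

lemma integral_count: "(\<integral> K. f (K v) \<partial>counts) = (\<integral> k. f k \<partial>measure_pmf q)" for f :: "nat \<Rightarrow> real"
  using integral_distr[of "\<lambda>K. K v" counts "measure_pmf q" f] by (simp add: distr_count)

text \<open>Splitting by the value of the root count and using independence evaluates the offspring
  generating function at the mean of \<open>h\<close>. It serves both the zero probability of
  \<open>growth\<close> and the exponential moment.\<close>

lemma nn_integral_prod_subcounts:
  fixes h :: "(nat list \<Rightarrow> nat) \<Rightarrow> real"
  assumes h [measurable]: "h \<in> borel_measurable counts" and nn: "\<And>K. h K \<ge> 0"
  shows "(\<integral>\<^sup>+ K. (\<Prod>i<K []. ennreal (h (subcounts [i] K))) \<partial>counts)
    = (\<Sum>k\<le>B. ennreal (pmf q k) * (\<integral>\<^sup>+ K. ennreal (h K) \<partial>counts) ^ k)"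
proof -
  have summand: "(\<integral>\<^sup>+ K. ennreal (indicator {k} (K [])) * (\<Prod>i<k. ennreal (h (subcounts [i] K))) \<partial>counts)
      = ennreal (pmf q k) * (\<integral>\<^sup>+ K. ennreal (h K) \<partial>counts) ^ k" for k
  proof -
    let ?X = "\<lambda>j K. case j of None \<Rightarrow> indicator {k} (K []) | Some i \<Rightarrow> h (subcounts [i] K)"
    let ?I = "insert None (Some ` {..<k})"
    have prod: "(\<Prod>j\<in>?I. f j) = f None * (\<Prod>i<k. f (Some i))" for f :: "nat option \<Rightarrow> ennreal"
      by (subst prod.insert) (auto simp: prod.reindex)
    have "counts.indep_vars (\<lambda>_. borel) ?X ?I"
      by (rule counts.indep_vars_subset[OF indep_root_subcounts]) simp_all
    then have "counts.indep_vars (\<lambda>_. borel) (\<lambda>j K. ennreal (?X j K)) ?I"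
      by (rule counts.indep_vars_compose2) simp
    then have "(\<integral>\<^sup>+ K. (\<Prod>j\<in>?I. ennreal (?X j K)) \<partial>counts) = (\<Prod>j\<in>?I. \<integral>\<^sup>+ K. ennreal (?X j K) \<partial>counts)"
      using nn by (intro counts.indep_vars_nn_integral) (auto split: option.split)
    then show ?thesis
      unfolding prod using nn_integral_count[of "\<lambda>x. indicator {k} x" "[]"]
      by (simp add: ennreal_indicator nn_integral_subcounts[where f = "\<lambda>K. ennreal (h K)"] emeasure_pmf_single)
  qed
  have "(\<integral>\<^sup>+ K. (\<Prod>i<K []. ennreal (h (subcounts [i] K))) \<partial>counts)
      = (\<integral>\<^sup>+ K. (\<Sum>k\<le>B. ennreal (indicator {k} (K [])) * (\<Prod>i<k. ennreal (h (subcounts [i] K)))) \<partial>counts)"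
  proof (rule nn_integral_cong_AE)
    show "AE K in counts. (\<Prod>i<K []. ennreal (h (subcounts [i] K)))
      = (\<Sum>k\<le>B. ennreal (indicator {k} (K [])) * (\<Prod>i<k. ennreal (h (subcounts [i] K))))"
      using AE_count_le
    proof eventually_elim
      case (elim K)
      have "(\<Sum>k\<le>B. ennreal (indicator {k} (K [])) * (\<Prod>i<k. ennreal (h (subcounts [i] K))))
          = (\<Sum>k\<le>B. if k = K [] then \<Prod>i<k. ennreal (h (subcounts [i] K)) else 0)"
        by (intro sum.cong) (auto simp: indicator_def)
      also have "\<dots> = (\<Prod>i<K []. ennreal (h (subcounts [i] K)))"
        using elim by (simp add: sum.delta')
      finally show ?case ..
    qed
  qed
  also have "\<dots> = (\<Sum>k\<le>B. ennreal (pmf q k) * (\<integral>\<^sup>+ K. ennreal (h K) \<partial>counts) ^ k)"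
  proof (subst nn_integral_sum)
    fix k
    have [measurable]: "(\<lambda>K. indicator {k} (K []) :: real) \<in> borel_measurable counts"
      by (rule measurable_compose[OF measurable_count]) simp
    show "(\<lambda>K. ennreal (indicator {k} (K [])) * (\<Prod>i<k. ennreal (h (subcounts [i] K)))) \<in> borel_measurable counts"
      by measurable
  qed (simp add: summand)
  finally show ?thesis .
qed

lemma measurable_sum_subcounts [measurable]:
  assumes [measurable]: "G \<in> borel_measurable counts"
  shows "(\<lambda>K. \<Sum>i<K []. G (subcounts [i] K) :: real) \<in> borel_measurable counts"
  by (rule measurable_compose_countable[where f = "\<lambda>k K. \<Sum>i<k. G (subcounts [i] K)"]) measurable

lemma measurable_gen_sum [measurable]:
  assumes [measurable]: "Y \<in> borel_measurable counts"
  shows "gen_sum Y n \<in> borel_measurable counts"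
proof (induction n)
  case 0
  have "gen_sum Y 0 = Y" by auto
  then show ?case using assms by simp
next
  case (Suc n)
  have "gen_sum Y (Suc n) = (\<lambda>K. \<Sum>i<K []. gen_sum Y n (subcounts [i] K))" by auto
  with Suc show ?case by simp
qed

section \<open>First and second moments of sums over a generation\<close>

lemma expectation_root_subcounts:
  fixes \<phi> :: "nat \<Rightarrow> real" and G :: "(nat list \<Rightarrow> nat) \<Rightarrow> real"
  assumes \<phi>: "integrable (measure_pmf q) \<phi>" and G: "integrable counts G"
  shows "integrable counts (\<lambda>K. \<phi> (K []) * G (subcounts [i] K))" (is ?int)
    and "(\<integral> K. \<phi> (K []) * G (subcounts [i] K) \<partial>counts) = measure_pmf.expectation q \<phi> * (\<integral> K. G K \<partial>counts)" (is ?eq)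
    and "i \<noteq> j \<Longrightarrow> integrable counts (\<lambda>K. \<phi> (K []) * (G (subcounts [i] K) * G (subcounts [j] K)))"
    and "i \<noteq> j \<Longrightarrow> (\<integral> K. \<phi> (K []) * (G (subcounts [i] K) * G (subcounts [j] K)) \<partial>counts)
      = measure_pmf.expectation q \<phi> * ((\<integral> K. G K \<partial>counts) * (\<integral> K. G K \<partial>counts))"
proof -
  let ?X = "\<lambda>j K. case j of None \<Rightarrow> \<phi> (K []) | Some i \<Rightarrow> G (subcounts [i] K)"
  have [measurable]: "G \<in> borel_measurable counts"
    using G by simp
  have indep: "counts.indep_vars (\<lambda>_. borel) ?X I" for I
    by (rule counts.indep_vars_subset[OF indep_root_subcounts]) auto
  have "integrable counts (\<lambda>K. \<phi> (K []))"
    using integrable_distr[of "\<lambda>K. K []" counts "measure_pmf q" \<phi>] \<phi> by (simp add: distr_count)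
  then have int: "integrable counts (?X j)" for j
    by (cases j) (auto intro!: integrable_subcounts G)
  note * = counts.indep_vars_integrable[OF _ indep int] counts.indep_vars_lebesgue_integral[OF _ indep int]
  show ?int ?eq
    using *[of "{None, Some i}"] by (simp_all add: integral_count integral_subcounts)
  assume "i \<noteq> j"
  then show "integrable counts (\<lambda>K. \<phi> (K []) * (G (subcounts [i] K) * G (subcounts [j] K)))"
    "(\<integral> K. \<phi> (K []) * (G (subcounts [i] K) * G (subcounts [j] K)) \<partial>counts)
      = measure_pmf.expectation q \<phi> * ((\<integral> K. G K \<partial>counts) * (\<integral> K. G K \<partial>counts))"
    using *[of "{None, Some i, Some j}"] by (simp_all add: integral_count integral_subcounts)
qed

text \<open>A random range of summation is traded for a fixed one, so that linearity and
  independence apply term by term.\<close>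

lemma AE_sum_subcounts:
  "AE K in counts. (\<Sum>i<K []. G (subcounts [i] K)) = (\<Sum>i<B. indicator {k. i < k} (K []) * G (subcounts [i] K))"
  for G :: "_ \<Rightarrow> real"
  using AE_count_le
proof eventually_elim
  case (elim K)
  have "{..<B} \<inter> {i. i < K []} = {..<K []}"
    using elim by (auto intro: less_le_trans)
  moreover have "(\<Sum>i<B. indicator {k. i < k} (K []) * G (subcounts [i] K))
      = (\<Sum>i<B. if i < K [] then G (subcounts [i] K) else 0)"
    by (intro sum.cong) auto
  ultimately show ?case
    by (simp add: sum.If_cases)
qed

lemma integrable_indicator_q: "integrable (measure_pmf q) (indicator A :: nat \<Rightarrow> real)"
  by (rule measure_pmf.integrable_const_bound[where B = 1]) auto

lemma expectation_sum_subcounts: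
  fixes G :: "(nat list \<Rightarrow> nat) \<Rightarrow> real"
  assumes G: "integrable counts G"
  shows "integrable counts (\<lambda>K. \<Sum>i<K []. G (subcounts [i] K))"
    and "(\<integral> K. (\<Sum>i<K []. G (subcounts [i] K)) \<partial>counts) = m * (\<integral> K. G K \<partial>counts)"
proof -
  have [measurable]: "G \<in> borel_measurable counts"
    using G by simp
  let ?S = "\<lambda>K. \<Sum>i<B. indicator {k. i < k} (K []) * G (subcounts [i] K)"
  note * = expectation_root_subcounts(1,2)[OF integrable_indicator_q G]
  have "integrable counts ?S"
    by (intro Bochner_Integration.integrable_sum *)
  then show "integrable counts (\<lambda>K. \<Sum>i<K []. G (subcounts [i] K))"
    by (rule integrable_cong_AE_imp) (use AE_sum_subcounts[of G] in \<open>auto\<close>)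
  have "(\<integral> K. (\<Sum>i<K []. G (subcounts [i] K)) \<partial>counts) = (\<integral> K. ?S K \<partial>counts)"
    by (rule integral_cong_AE) (use AE_sum_subcounts[of G] in \<open>auto\<close>)
  also have "\<dots> = (\<Sum>i<B. measure_pmf.prob q {k. i < k}) * (\<integral> K. G K \<partial>counts)"
    by (subst Bochner_Integration.integral_sum[OF *(1)], subst *(2)) (simp add: sum_distrib_right)
  finally show "(\<integral> K. (\<Sum>i<K []. G (subcounts [i] K)) \<partial>counts) = m * (\<integral> K. G K \<partial>counts)"
    by (simp add: sum_prob_less)
qed

text \<open>In the expanded square the off-diagonal terms vanish by independence and zero mean; the
  diagonal ones add up by \<open>sum_prob_less\<close>.\<close>

lemma variance_sum_subcounts:
  fixes G :: "(nat list \<Rightarrow> nat) \<Rightarrow> real"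
  assumes G: "integrable counts G" and G2: "integrable counts (\<lambda>K. (G K)\<^sup>2)"
    and mean: "(\<integral> K. G K \<partial>counts) = 0"
  shows "integrable counts (\<lambda>K. (\<Sum>i<K []. G (subcounts [i] K))\<^sup>2)"
    and "(\<integral> K. (\<Sum>i<K []. G (subcounts [i] K))\<^sup>2 \<partial>counts) = m * (\<integral> K. (G K)\<^sup>2 \<partial>counts)"
proof -
  have [measurable]: "G \<in> borel_measurable counts"
    using G by simp
  let ?t = "\<lambda>i j K. indicator {k. i < k \<and> j < k} (K []) * (G (subcounts [i] K) * G (subcounts [j] K))"
  let ?S = "\<lambda>K. \<Sum>i<B. \<Sum>j<B. ?t i j K"
  have AE: "AE K in counts. (\<Sum>i<K []. G (subcounts [i] K))\<^sup>2 = ?S K"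
    using AE_sum_subcounts[of G]
  proof eventually_elim
    case (elim K)
    show ?case
      unfolding elim power2_eq_square sum_product by (intro sum.cong refl) (simp add: indicator_def)
  qed
  note sq = expectation_root_subcounts(1,2)[OF integrable_indicator_q G2]
  note cross = expectation_root_subcounts(3,4)[OF integrable_indicator_q G]
  have int: "integrable counts (?t i j)" for i j
    using sq(1)[of "{k. i < k}" i] cross(1)[of i j "{k. i < k \<and> j < k}"]
    by (cases "i = j") (auto simp: power2_eq_square)
  have val: "(\<integral> K. ?t i j K \<partial>counts)
      = (if i = j then measure_pmf.prob q {k. i < k} * (\<integral> K. (G K)\<^sup>2 \<partial>counts) else 0)" for i j
    using sq(2)[of "{k. i < k}" i] cross(2)[of i j "{k. i < k \<and> j < k}"] mean
    by (cases "i = j") (auto simp: power2_eq_square)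
  have "integrable counts ?S"
    by (intro Bochner_Integration.integrable_sum int)
  then show "integrable counts (\<lambda>K. (\<Sum>i<K []. G (subcounts [i] K))\<^sup>2)"
    by (rule integrable_cong_AE_imp) (use AE in auto)
  have "(\<integral> K. (\<Sum>i<K []. G (subcounts [i] K))\<^sup>2 \<partial>counts) = (\<integral> K. ?S K \<partial>counts)"
    by (rule integral_cong_AE) (use AE in auto)
  also have "\<dots> = (\<Sum>i<B. \<Sum>j<B. \<integral> K. ?t i j K \<partial>counts)"
    by (simp add: Bochner_Integration.integral_sum int Bochner_Integration.integrable_sum
        del: sum_mult_indicator sum_indicator_mult)
  also have "\<dots> = (\<Sum>i<B. measure_pmf.prob q {k. i < k}) * (\<integral> K. (G K)\<^sup>2 \<partial>counts)"
    by (simp add: val sum.delta' sum_distrib_right)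
  finally show "(\<integral> K. (\<Sum>i<K []. G (subcounts [i] K))\<^sup>2 \<partial>counts) = m * (\<integral> K. (G K)\<^sup>2 \<partial>counts)"
    by (simp add: sum_prob_less)
qed

lemma measure_counts_UNIV [simp]: "measure counts UNIV = 1" "emeasure counts UNIV = 1"
  using counts.prob_space counts.emeasure_space_1 by simp_all

lemma gen_sum_moments:
  fixes Y :: "(nat list \<Rightarrow> nat) \<Rightarrow> real"
  assumes Y: "integrable counts Y"
  shows "integrable counts (gen_sum Y n)" "(\<integral> K. gen_sum Y n K \<partial>counts) = m ^ n * (\<integral> K. Y K \<partial>counts)"
proof -
  have "integrable counts (gen_sum Y n) \<and> (\<integral> K. gen_sum Y n K \<partial>counts) = m ^ n * (\<integral> K. Y K \<partial>counts)"
  proof (induction n)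
    case (Suc n)
    then show ?case
      using expectation_sum_subcounts[of "gen_sum Y n"] by (simp add: fun_eq_iff[symmetric] gen_sum.simps(2)[abs_def])
  qed (use Y in \<open>simp add: gen_sum.simps(1)[abs_def]\<close>)
  then show "integrable counts (gen_sum Y n)" "(\<integral> K. gen_sum Y n K \<partial>counts) = m ^ n * (\<integral> K. Y K \<partial>counts)"
    by auto
qed

lemma gen_sum_variance:
  fixes Y :: "(nat list \<Rightarrow> nat) \<Rightarrow> real"
  assumes Y: "integrable counts Y" "integrable counts (\<lambda>K. (Y K)\<^sup>2)" and mean: "(\<integral> K. Y K \<partial>counts) = 0"
  shows "integrable counts (\<lambda>K. (gen_sum Y n K)\<^sup>2)"
    "(\<integral> K. (gen_sum Y n K)\<^sup>2 \<partial>counts) = m ^ n * (\<integral> K. (Y K)\<^sup>2 \<partial>counts)"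
proof -
  have "integrable counts (\<lambda>K. (gen_sum Y n K)\<^sup>2) \<and>
    (\<integral> K. (gen_sum Y n K)\<^sup>2 \<partial>counts) = m ^ n * (\<integral> K. (Y K)\<^sup>2 \<partial>counts)"
  proof (induction n)
    case (Suc n)
    then show ?case
      using variance_sum_subcounts[of "gen_sum Y n"] gen_sum_moments[OF Y(1), of n] mean by simp
  qed (use Y in simp)
  then show "integrable counts (\<lambda>K. (gen_sum Y n K)\<^sup>2)"
    "(\<integral> K. (gen_sum Y n K)\<^sup>2 \<partial>counts) = m ^ n * (\<integral> K. (Y K)\<^sup>2 \<partial>counts)"
    by auto
qed

text \<open>The second moment of \<open>gen_sum Y n\<close> is of order \<open>m ^ n\<close>, so
  after division by \<open>m ^ n\<close> the first absolute moments decay geometrically.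
  Integrability of the whole series also provides a dominating function later on.\<close>

lemma nn_integral_suminf_gen_sum:
  fixes Y :: "(nat list \<Rightarrow> nat) \<Rightarrow> real"
  assumes Y: "integrable counts Y" "integrable counts (\<lambda>K. (Y K)\<^sup>2)" and mean: "(\<integral> K. Y K \<partial>counts) = 0"
  shows "(\<integral>\<^sup>+ K. (\<Sum>n. ennreal (\<bar>gen_sum Y n K\<bar> / m ^ n)) \<partial>counts) < \<infinity>"
proof -
  have [measurable]: "Y \<in> borel_measurable counts" using Y by simp
  \<comment> \<open>The standard deviation is of order \<open>r ^ n\<close> while
    \<open>m ^ n = r ^ (2 * n)\<close>, which leaves the decay rate \<open>1 / r\<close>.\<close>
  define r where "r = sqrt m"
  have r: "r > 1" "m = r ^ 2"
    using m_gt_1 by (auto simp: r_def)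
  define c where "c = (1 + (\<integral> K. (Y K)\<^sup>2 \<partial>counts)) / 2"
  have c: "c \<ge> 0" unfolding c_def by simp
  have "(\<integral>\<^sup>+ K. ennreal (\<bar>gen_sum Y n K\<bar> / m ^ n) \<partial>counts) \<le> ennreal (c * (1 / r) ^ n)" for n
  proof -
    have int: "integrable counts (\<lambda>K. (1 / r ^ n) / 2 + (gen_sum Y n K)\<^sup>2 * (1 / (2 * r ^ (3 * n))))"
      using gen_sum_variance(1)[OF Y mean, of n] by simp
    \<comment> \<open>An AM-GM inequality with \<open>t = r ^ n\<close> in place of Cauchy--Schwarz,
      weighted so that both terms are of order \<open>1 / t\<close> after integration.\<close>
    have le: "\<bar>x\<bar> / m ^ n \<le> (1 / r ^ n) / 2 + x\<^sup>2 * (1 / (2 * r ^ (3 * n)))" for x :: real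
    proof -
      define t where "t = r ^ n"
      have t: "t > 0" using r by (simp add: t_def)
      have eq: "m ^ n = t ^ 2" "r ^ (3 * n) = t ^ 3"
        by (simp_all add: r(2) t_def power_mult[symmetric] mult.commute)
      have "0 \<le> (t - \<bar>x\<bar>)\<^sup>2" by simp
      then have "2 * t * \<bar>x\<bar> \<le> t\<^sup>2 + x\<^sup>2"
        by (simp add: power2_diff)
      then have "2 * t * \<bar>x\<bar> / (2 * t ^ 3) \<le> (t\<^sup>2 + x\<^sup>2) / (2 * t ^ 3)"
        using t by (intro divide_right_mono) auto
      moreover have "2 * t * \<bar>x\<bar> / (2 * t ^ 3) = \<bar>x\<bar> / t\<^sup>2"
        "(t\<^sup>2 + x\<^sup>2) / (2 * t ^ 3) = 1 / t / 2 + x\<^sup>2 * (1 / (2 * t ^ 3))"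
        using t by (auto simp: field_simps power2_eq_square power3_eq_cube)
      ultimately show ?thesis
        unfolding eq by (simp add: t_def)
    qed
    have "(\<integral>\<^sup>+ K. ennreal (\<bar>gen_sum Y n K\<bar> / m ^ n) \<partial>counts)
        \<le> (\<integral>\<^sup>+ K. ennreal ((1 / r ^ n) / 2 + (gen_sum Y n K)\<^sup>2 * (1 / (2 * r ^ (3 * n)))) \<partial>counts)"
      by (intro nn_integral_mono ennreal_leI le)
    also have "\<dots> = ennreal (\<integral> K. (1 / r ^ n) / 2 + (gen_sum Y n K)\<^sup>2 * (1 / (2 * r ^ (3 * n))) \<partial>counts)"
      using r by (intro nn_integral_eq_integral int) simp
    also have "(\<integral> K. (1 / r ^ n) / 2 + (gen_sum Y n K)\<^sup>2 * (1 / (2 * r ^ (3 * n))) \<partial>counts)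
        = (1 / r ^ n) / 2 + m ^ n * (\<integral> K. (Y K)\<^sup>2 \<partial>counts) * (1 / (2 * r ^ (3 * n)))"
      using gen_sum_variance[OF Y mean, of n] by simp
    also have "\<dots> = c * (1 / r) ^ n"
    proof -
      have "m ^ n * (1 / (2 * r ^ (3 * n))) = (1 / r ^ n) / 2"
        using r(1) by (simp add: r(2) power_mult[symmetric] divide_simps power_add[symmetric])
      then have "m ^ n * (\<integral> K. (Y K)\<^sup>2 \<partial>counts) * (1 / (2 * r ^ (3 * n)))
          = (\<integral> K. (Y K)\<^sup>2 \<partial>counts) * ((1 / r ^ n) / 2)"
        by (simp only: mult.commute[of "m ^ n" "\<integral> K. (Y K)\<^sup>2 \<partial>counts"] mult.assoc)
      then show ?thesis
        by (simp add: c_def power_one_over add_divide_distrib)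
    qed
    finally show ?thesis .
  qed
  then have "(\<Sum>n. \<integral>\<^sup>+ K. ennreal (\<bar>gen_sum Y n K\<bar> / m ^ n) \<partial>counts) \<le> (\<Sum>n. ennreal (c * (1 / r) ^ n))"
    by (intro suminf_le) auto
  also have "\<dots> = ennreal (\<Sum>n. c * (1 / r) ^ n)"
    using r c by (intro suminf_ennreal2 summable_mult summable_geometric) auto
  also have "\<dots> < \<infinity>" by simp
  finally show ?thesis
    by (subst nn_integral_suminf) auto
qed

lemma AE_summable_gen_sum:
  fixes Y :: "(nat list \<Rightarrow> nat) \<Rightarrow> real"
  assumes Y: "integrable counts Y" "integrable counts (\<lambda>K. (Y K)\<^sup>2)" and mean: "(\<integral> K. Y K \<partial>counts) = 0"
  shows "AE K in counts. summable (\<lambda>n. \<bar>gen_sum Y n K\<bar> / m ^ n)"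
proof -
  have [measurable]: "Y \<in> borel_measurable counts" using Y by simp
  have "AE K in counts. (\<Sum>n. ennreal (\<bar>gen_sum Y n K\<bar> / m ^ n)) \<noteq> \<infinity>"
    by (rule nn_integral_PInf_AE) (use nn_integral_suminf_gen_sum[OF Y mean] in auto)
  then show ?thesis
    by eventually_elim (rule summable_suminf_not_top, use m_gt_1 in auto)
qed

section \<open>The normalised population and its limit\<close>

definition pop :: "nat \<Rightarrow> (nat list \<Rightarrow> nat) \<Rightarrow> real" where
  "pop n K = gen_sum (\<lambda>_. 1) n K / m ^ n"

text \<open>\<open>lim\<close> keeps this measurable on the whole space; its value is informative
  where \<open>pop\<close> converges, which is almost everywhere.\<close>

definition growth :: "(nat list \<Rightarrow> nat) \<Rightarrow> real" where
  "growth K = lim (\<lambda>n. pop n K)"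

lemma measurable_pop [measurable]: "pop n \<in> borel_measurable counts"
  unfolding pop_def[abs_def] by measurable

lemma measurable_growth [measurable]: "growth \<in> borel_measurable counts"
  unfolding growth_def[abs_def] by (intro borel_measurable_lim_metric) simp

lemma pop_nonneg: "pop n K \<ge> 0"
  unfolding pop_def using m_gt_1 by (simp add: gen_sum_nonneg)

text \<open>The centred offspring number: its generation sum is the population at level
  \<open>n + 1\<close> minus \<open>m\<close> times that at level \<open>n\<close>, hence the
  increment of \<open>pop\<close> up to scaling.\<close>

definition surplus :: "(nat list \<Rightarrow> nat) \<Rightarrow> real" where
  "surplus K = real (K []) - m"

lemma measurable_surplus [measurable]: "surplus \<in> borel_measurable counts"
proof -
  have "(\<lambda>k. real k - m) \<in> borel_measurable (count_space UNIV)" by simp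
  from measurable_compose[OF measurable_count this, of "[]"] show ?thesis
    by (simp add: surplus_def[abs_def])
qed

lemma surplus_moments:
  "integrable counts surplus" "integrable counts (\<lambda>K. (surplus K)\<^sup>2)" "(\<integral> K. surplus K \<partial>counts) = 0"
proof -
  have bound: "AE K in counts. \<bar>surplus K\<bar> \<le> real B + m"
    using AE_count_le
  proof eventually_elim
    case (elim K)
    then have "real (K []) \<le> real B" by simp
    then show ?case
      unfolding surplus_def using m_gt_1 by linarith
  qed
  show "integrable counts surplus"
    by (rule counts.integrable_const_bound[where B = "real B + m"]) (use bound in auto)
  have "AE K in counts. \<bar>surplus K\<bar>\<^sup>2 \<le> (real B + m)\<^sup>2"
    using bound by eventually_elim (rule power_mono, auto)
  then show "integrable counts (\<lambda>K. (surplus K)\<^sup>2)"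
    by (intro counts.integrable_const_bound[where B = "(real B + m)\<^sup>2"]) auto
  have "(\<integral> K. surplus K \<partial>counts) = (\<Sum>k\<le>B. (real k - m) * pmf q k)"
    using integral_count[of "\<lambda>k. real k - m" "[]"] by (simp add: surplus_def expectation_q)
  also have "\<dots> = 0"
    using sum_q by (simp add: left_diff_distrib sum_subtractf m_eq[symmetric] sum_distrib_left[symmetric])
  finally show "(\<integral> K. surplus K \<partial>counts) = 0" .
qed

lemma pop_Suc_diff: "pop (Suc n) K - pop n K = gen_sum surplus n K / m ^ n / m"
proof -
  have "gen_sum surplus n K = gen_sum (\<lambda>K. \<Sum>i<K []. 1) n K - m * gen_sum (\<lambda>_. 1) n K"
    using gen_sum_diff[of "\<lambda>K. \<Sum>i<K []. 1" m "\<lambda>_. 1" n K] by (simp add: surplus_def[abs_def])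
  also have "gen_sum (\<lambda>K. \<Sum>i<K []. 1) n K = gen_sum (\<lambda>_. 1) (Suc n) K"
    by (simp only: gen_sum_Suc')
  finally show ?thesis
    using m_gt_1 by (simp add: pop_def field_simps del: gen_sum.simps)
qed

lemma pop_Suc: "pop (Suc n) K = (\<Sum>i<K []. pop n (subcounts [i] K)) / m"
  by (simp add: pop_def sum_divide_distrib mult.commute)

lemma pop_0 [simp]: "pop 0 K = 1"
  by (simp add: pop_def)

text \<open>The increments of \<open>pop\<close> are generation sums of a centred variable, hence
  almost surely absolutely summable.\<close>

lemma AE_convergent_pop: "AE K in counts. convergent (\<lambda>n. pop n K)"
  using AE_summable_gen_sum[OF surplus_moments]
proof eventually_elim
  case (elim K)
  then have "summable (\<lambda>n. \<bar>gen_sum surplus n K / m ^ n\<bar>)"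
    using m_gt_1 by simp
  then have "summable (\<lambda>n. gen_sum surplus n K / m ^ n / m)"
    by (rule summable_divide[OF summable_rabs_cancel])
  then have "summable (\<lambda>n. pop (Suc n) K - pop n K)"
    by (simp only: pop_Suc_diff)
  then have "convergent (\<lambda>n. \<Sum>k<n. pop (Suc k) K - pop k K)"
    by (simp add: summable_iff_convergent)
  then have "convergent (\<lambda>n. (pop n K - pop 0 K) + pop 0 K)"
    by (intro convergent_add convergent_const) (simp only: sum_lessThan_telescope[of "\<lambda>n. pop n K"])
  then show ?case by simp
qed

lemma AE_convergent_pop_subcounts: "AE K in counts. \<forall>v. convergent (\<lambda>n. pop n (subcounts v K))"
  by (subst AE_all_countable) (intro allI AE_subcounts AE_convergent_pop)

lemma pop_LIMSEQ_growth: "convergent (\<lambda>n. pop n K) \<Longrightarrow> (\<lambda>n. pop n K) \<longlonglongrightarrow> growth K"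
  by (simp add: growth_def convergent_LIMSEQ_iff)

lemma growth_nonneg: "convergent (\<lambda>n. pop n K) \<Longrightarrow> growth K \<ge> 0"
  using LIMSEQ_le_const[OF pop_LIMSEQ_growth] pop_nonneg by blast

lemma growth_split:
  assumes "\<And>v. convergent (\<lambda>n. pop n (subcounts v K))"
  shows "growth K = (\<Sum>i<K []. growth (subcounts [i] K)) / m"
proof -
  have "(\<lambda>n. pop (Suc n) K) \<longlonglongrightarrow> (\<Sum>i<K []. growth (subcounts [i] K)) / m"
    unfolding pop_Suc using m_gt_1 assms by (intro tendsto_intros pop_LIMSEQ_growth) auto
  moreover have "(\<lambda>n. pop (Suc n) K) \<longlonglongrightarrow> growth K"
    using pop_LIMSEQ_growth[of K] assms[of "[]"] by (intro LIMSEQ_Suc) simp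
  ultimately show ?thesis
    by (rule LIMSEQ_unique[rotated])
qed

lemma nn_integral_pop: "(\<integral>\<^sup>+ K. ennreal (pop n K) \<partial>counts) = 1"
proof -
  have int: "integrable counts (pop n)"
    unfolding pop_def[abs_def] using gen_sum_moments(1)[of "\<lambda>_. 1" n] by simp
  have "(\<integral>\<^sup>+ K. ennreal (pop n K) \<partial>counts) = ennreal (\<integral> K. pop n K \<partial>counts)"
    by (rule nn_integral_eq_integral[OF int]) (simp add: pop_nonneg)
  also have "(\<integral> K. pop n K \<partial>counts) = 1"
    unfolding pop_def using gen_sum_moments(2)[of "\<lambda>_. 1" n] m_gt_1 by (simp add: counts.prob_space)
  finally show ?thesis by simp
qed

text \<open>Every \<open>pop n\<close> has mean 1 and, by telescoping, is dominated by 1 plus the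
  integrable series of absolute increments. Thus no mass is lost in the limit, and
  \<open>growth\<close> cannot vanish almost surely.\<close>

lemma nn_integral_growth: "(\<integral>\<^sup>+ K. ennreal (growth K) \<partial>counts) = 1"
proof -
  let ?w = "\<lambda>K. 1 + (\<Sum>n. ennreal (\<bar>gen_sum surplus n K\<bar> / m ^ n))"
  have "(\<lambda>n. \<integral>\<^sup>+ K. ennreal (pop n K) \<partial>counts) \<longlonglongrightarrow> (\<integral>\<^sup>+ K. ennreal (growth K) \<partial>counts)"
  proof (rule nn_integral_dominated_convergence[where w = ?w])
    show "AE K in counts. (\<lambda>n. ennreal (pop n K)) \<longlonglongrightarrow> ennreal (growth K)"
      using AE_convergent_pop by eventually_elim (intro tendsto_ennrealI pop_LIMSEQ_growth)
    show "(\<integral>\<^sup>+ K. ?w K \<partial>counts) < \<infinity>"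
      using nn_integral_suminf_gen_sum[OF surplus_moments]
      by (subst nn_integral_add) (auto simp: counts.emeasure_space_1)
    fix n
    have "ennreal (pop n K) \<le> ?w K" for K
    proof -
      have "pop n K = 1 + (\<Sum>k<n. pop (Suc k) K - pop k K)"
        using sum_lessThan_telescope[of "\<lambda>n. pop n K" n] by simp
      also have "\<dots> \<le> 1 + (\<Sum>k<n. \<bar>gen_sum surplus k K\<bar> / m ^ k)"
      proof (intro add_left_mono sum_mono)
        fix k
        have "pop (Suc k) K - pop k K \<le> \<bar>gen_sum surplus k K\<bar> / m ^ k / m"
          unfolding pop_Suc_diff using m_gt_1 by (intro divide_right_mono) auto
        also have "\<dots> \<le> \<bar>gen_sum surplus k K\<bar> / m ^ k / 1"
          using m_gt_1 by (intro divide_left_mono) auto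
        also have "\<dots> = \<bar>gen_sum surplus k K\<bar> / m ^ k"
          by simp
        finally show "pop (Suc k) K - pop k K \<le> \<bar>gen_sum surplus k K\<bar> / m ^ k" .
      qed
      finally have "ennreal (pop n K) \<le> ennreal (1 + (\<Sum>k<n. \<bar>gen_sum surplus k K\<bar> / m ^ k))"
        by (rule ennreal_leI)
      also have "\<dots> = 1 + ennreal (\<Sum>k<n. \<bar>gen_sum surplus k K\<bar> / m ^ k)"
        using m_gt_1 by (subst ennreal_plus) (auto simp: sum_nonneg)
      also have "\<dots> = 1 + (\<Sum>k<n. ennreal (\<bar>gen_sum surplus k K\<bar> / m ^ k))"
        using m_gt_1 by (subst sum_ennreal) auto
      also have "\<dots> \<le> ?w K"
        by (intro add_left_mono sum_le_suminf) auto
      finally show ?thesis .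
    qed
    then show "AE K in counts. ennreal (pop n K) \<le> ?w K" by simp
  qed measurable
  then have "(\<lambda>n::nat. 1 :: ennreal) \<longlonglongrightarrow> (\<integral>\<^sup>+ K. ennreal (growth K) \<partial>counts)"
    by (simp add: nn_integral_pop)
  then show ?thesis
    using LIMSEQ_unique tendsto_const by blast
qed

text \<open>The probability \<open>p\<close> that \<^const>\<open>growth\<close> vanishes solves \<open>p = f p\<close> for the probability generating
  function \<open>f\<close>, whose only fixed points in \<open>[0, 1]\<close> are 0 and 1.\<close>

lemma AE_growth_pos: "AE K in counts. growth K > 0"
proof -
  define h :: "(nat list \<Rightarrow> nat) \<Rightarrow> real" where "h K = indicator {0} (growth K)" for K
  have [measurable]: "h \<in> borel_measurable counts"
    unfolding h_def by measurable
  define p where "p = (\<integral> K. h K \<partial>counts)"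
  have int: "integrable counts h"
    by (rule counts.integrable_const_bound[where B = 1]) (auto simp: h_def)
  have p_eq: "(\<integral>\<^sup>+ K. ennreal (h K) \<partial>counts) = ennreal p"
    unfolding p_def by (rule nn_integral_eq_integral[OF int]) (simp add: h_def)
  have p01: "0 \<le> p" "p \<le> 1"
    unfolding p_def using int
    by (auto intro!: counts.integral_le_const Bochner_Integration.integral_nonneg simp: h_def[abs_def] simp del: indicator_simps)
  \<comment> \<open>\<open>growth\<close> vanishes exactly if it vanishes for all subtrees at the
    children of the root, so its zero indicator is multiplicative over them.\<close>
  have "AE K in counts. ennreal (h K) = (\<Prod>i<K []. ennreal (h (subcounts [i] K)))"
    using AE_convergent_pop_subcounts
  proof eventually_elim
    case (elim K)
    have "growth K = 0 \<longleftrightarrow> (\<forall>i\<in>{..<K []}. growth (subcounts [i] K) = 0)"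
      using growth_split[of K] elim m_gt_1 growth_nonneg by (simp add: sum_nonneg_eq_0_iff)
    moreover have "(\<Prod>i<K []. ennreal (h (subcounts [i] K)))
        = (if \<forall>i\<in>{..<K []}. growth (subcounts [i] K) = 0 then 1 else 0)"
      by (auto simp: h_def prod_zero_iff indicator_eq_0_iff)
    ultimately show ?case
      by (simp add: h_def)
  qed
  then have "ennreal p = (\<integral>\<^sup>+ K. (\<Prod>i<K []. ennreal (h (subcounts [i] K))) \<partial>counts)"
    unfolding p_eq[symmetric] by (rule nn_integral_cong_AE)
  also have "\<dots> = (\<Sum>k\<le>B. ennreal (pmf q k) * ennreal p ^ k)"
    by (subst nn_integral_prod_subcounts) (auto simp: h_def[abs_def] p_eq[unfolded h_def])
  also have "\<dots> = ennreal (\<Sum>k\<le>B. pmf q k * p ^ k)"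
    using p01 by (simp add: ennreal_power ennreal_mult'[symmetric] sum_ennreal)
  finally have fixpoint: "p = (\<Sum>k\<le>B. pmf q k * p ^ k)"
    using p01 by (simp add: sum_nonneg)
  \<comment> \<open>If \<open>p = 1\<close>, then \<open>growth\<close> is almost surely 0, against
    its mean 1.\<close>
  have "p \<noteq> 1"
  proof
    assume "p = 1"
    then have "(\<integral> K. 1 - h K \<partial>counts) = 0"
      using int by (simp add: p_def counts.prob_space)
    moreover have "integrable counts (\<lambda>K. 1 - h K)" "AE K in counts. 0 \<le> 1 - h K"
      using int by (simp, simp add: h_def indicator_def)
    ultimately have "AE K in counts. 1 - h K = 0"
      by (simp only: integral_nonneg_eq_0_iff_AE)
    then have "AE K in counts. growth K = 0"
      by eventually_elim (auto simp: h_def indicator_def split: if_splits)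
    then have "(\<integral>\<^sup>+ K. ennreal (growth K) \<partial>counts) = 0"
      by (subst nn_integral_0_iff_AE) auto
    then show False
      by (simp add: nn_integral_growth)
  qed
  with p01 have p1: "p < 1" by simp
  have "p = 0"
  proof (rule ccontr)
    assume "p \<noteq> 0"
    with p01 have p0: "p > 0" by simp
    \<comment> \<open>For \<open>0 < p < 1\<close> all terms of the generating function lie below
      those of \<open>p\<close> itself, \<open>pmf q 0 = 0\<close> settling \<open>k = 0\<close>;
      some \<open>k \<ge> 2\<close> of positive weight makes the inequality strict.\<close>
    have term_le: "pmf q k * p ^ k \<le> pmf q k * p" for k
    proof (cases k)
      case (Suc j)
      then show ?thesis
        using p0 p1 power_decreasing[of 1 k p] by (intro mult_left_mono) auto
    qed (use q0 in simp)
    have "\<exists>k\<le>B. k \<ge> 2 \<and> pmf q k > 0"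
    proof (rule ccontr)
      assume "\<not> ?thesis"
      then have *: "pmf q k = 0" if "k \<noteq> 1" for k
        using that q_bound[of k] q0
        by (cases "k \<le> B"; cases "k = 0") (auto simp: not_less intro: order.antisym)
      have "(\<Sum>k\<le>B. real k * pmf q k) \<le> (\<Sum>k\<le>B. pmf q k)"
        by (intro sum_mono) (metis * mult_cancel_right1 of_nat_1 order_refl mult_zero_right)
      then show False
        using m_gt_1 sum_q m_eq by simp
    qed
    then obtain k where k: "k \<le> B" "k \<ge> 2" "pmf q k > 0" by blast
    have "p ^ k \<le> p ^ 2"
      using k p0 p1 by (intro power_decreasing) auto
    also have "p ^ 2 < p"
      using p0 p1 by (simp add: power2_eq_square)
    finally have "(\<Sum>k\<le>B. pmf q k * p ^ k) < (\<Sum>k\<le>B. pmf q k * p)"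
      using k term_le by (intro sum_strict_mono_ex1 bexI[of _ k]) auto
    then show False
      using fixpoint sum_q by (simp add: sum_distrib_right[symmetric])
  qed
  then have "AE K in counts. h K = 0"
    using integral_nonneg_eq_0_iff_AE[OF int] by (simp add: p_def) (simp add: h_def)
  then show ?thesis
    using AE_convergent_pop
  proof eventually_elim
    case (elim K)
    then show ?case
      using growth_nonneg[of K] by (auto simp: h_def indicator_def order.order_iff_strict split: if_splits)
  qed
qed

end

section \<open>An exponential moment of the growth limit\<close>

context offspring
begin

lemma exp_le_quadratic: "exp x \<le> 1 + x + x\<^sup>2" if "0 \<le> x" "x \<le> 1" for x :: real
  using exp_bound[OF that] .

text \<open>A second-order bound for the moment generating function of the offspring number;
  \<open>real B * t \<le> 1\<close> keeps all exponents in the range of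
  \<open>exp_le_quadratic\<close>.\<close>

lemma sum_pmf_exp_le:
  assumes t: "0 \<le> t" "real B * t \<le> 1"
  shows "(\<Sum>k\<le>B. pmf q k * exp (real k * t)) \<le> exp (m * t + (real B * t)\<^sup>2)"
proof -
  have "(\<Sum>k\<le>B. pmf q k * exp (real k * t)) \<le> (\<Sum>k\<le>B. pmf q k * (1 + real k * t + (real B * t)\<^sup>2))"
  proof (intro sum_mono mult_left_mono)
    fix k assume "k \<in> {..B}"
    then have k: "real k * t \<le> real B * t"
      using t by (intro mult_right_mono) auto
    have "exp (real k * t) \<le> 1 + real k * t + (real k * t)\<^sup>2"
      using t k by (intro exp_le_quadratic) auto
    also have "\<dots> \<le> 1 + real k * t + (real B * t)\<^sup>2"
      using t k by (intro add_left_mono power_mono) auto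
    finally show "exp (real k * t) \<le> 1 + real k * t + (real B * t)\<^sup>2" .
  qed simp
  also have "\<dots> = 1 + m * t + (real B * t)\<^sup>2"
  proof -
    have "(\<Sum>k\<le>B. pmf q k * (1 + real k * t + (real B * t)\<^sup>2))
        = (\<Sum>k\<le>B. pmf q k) + (\<Sum>k\<le>B. real k * pmf q k) * t + (\<Sum>k\<le>B. pmf q k) * (real B * t)\<^sup>2"
      unfolding sum_distrib_right sum.distrib[symmetric] by (intro sum.cong) (auto simp: algebra_simps)
    then show ?thesis
      by (simp add: sum_q m_eq[symmetric])
  qed
  also have "\<dots> \<le> exp (m * t + (real B * t)\<^sup>2)"
    using exp_ge_add_one_self[of "m * t + (real B * t)\<^sup>2"] by (simp only: add.assoc)
  finally show ?thesis .
qed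

text \<open>Induction on \<open>n\<close> of the stronger bound
  \<open>exp (s + C * s\<^sup>2)\<close> for all small \<open>s\<close>: conditioning on the root
  replaces \<open>s\<close> by \<open>s / m\<close>, and the quadratic term leaves room for the
  error of \<open>sum_pmf_exp_le\<close>.\<close>

lemma ex_exp_moment_pop:
  "\<exists>s>0. \<forall>n. (\<integral>\<^sup>+ K. ennreal (exp (s * pop n K)) \<partial>counts) \<le> ennreal (exp (s + 1))"
proof -
  have B: "B > 0"
  proof (rule ccontr)
    assume "\<not> B > 0"
    then show False
      using sum_q q0 by simp
  qed
  \<comment> \<open>\<open>C\<close> solves the requirement \<open>Cm\<close>, under which the
    quadratic coefficient reproduces itself. The added 1 gives \<open>C \<ge> 1\<close> and hence
    \<open>s0 \<le> 1\<close>.\<close>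
  define C where "C = (2 * real B)\<^sup>2 / (m - 1) + 1"
  have C: "C \<ge> 1"
    using m_gt_1 by (simp add: C_def)
  have Cm: "C / m + (2 * real B / m)\<^sup>2 \<le> C"
  proof -
    have "C * (m - 1) = (2 * real B)\<^sup>2 + (m - 1)"
      using m_gt_1 by (simp add: C_def distrib_right)
    then have "(2 * real B)\<^sup>2 \<le> C * (m - 1)"
      using m_gt_1 by simp
    also have "\<dots> = C * (m - 1) * 1" by simp
    also have "\<dots> \<le> C * (m - 1) * m"
      using m_gt_1 C by (intro mult_left_mono) auto
    finally show ?thesis
      using m_gt_1 by (simp add: field_simps power2_eq_square)
  qed
  \<comment> \<open>The first bound yields \<open>t \<le> 2 * (s / m)\<close> below, the second then
    \<open>real B * t \<le> 1\<close>.\<close>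
  define s0 where "s0 = min (1 / C) (1 / (2 * real B))"
  have s0: "s0 > 0" "C * s0 \<le> 1" "2 * real B * s0 \<le> 1"
    using C B by (auto simp: s0_def min_def field_simps)
  have main: "(\<integral>\<^sup>+ K. ennreal (exp (s * pop n K)) \<partial>counts) \<le> ennreal (exp (s + C * s\<^sup>2))"
    if "0 \<le> s" "s \<le> s0" for s n
    using that
  proof (induction n arbitrary: s)
    case 0
    then show ?case
      using C by (simp add: ennreal_leI)
  next
    case (Suc n)
    \<comment> \<open>The exponent that the induction hypothesis supplies for each subtree, at
      parameter \<open>s / m\<close>.\<close>
    define t where "t = s / m + C * (s / m)\<^sup>2"
    have sm: "0 \<le> s / m" "s / m \<le> s"
      using Suc.prems m_gt_1 divide_left_mono[of 1 m s] by auto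
    have "C * (s / m) \<le> 1"
      using mult_left_mono[of "s / m" s0 C] sm Suc.prems C s0 by linarith
    then have "C * (s / m)\<^sup>2 \<le> s / m"
      using sm mult_right_mono[of "C * (s / m)" 1 "s / m"] by (simp add: power2_eq_square mult.assoc)
    then have t: "0 \<le> t" "t \<le> 2 * (s / m)"
      using sm C by (auto simp: t_def)
    have Bt: "real B * t \<le> 1"
    proof -
      have "real B * t \<le> real B * (2 * s0)"
        using t sm Suc.prems by (intro mult_left_mono) auto
      with s0 show ?thesis by simp
    qed
    have exp_eq: "exp (s * pop (Suc n) K) = (\<Prod>i<K []. exp (s / m * pop n (subcounts [i] K)))" for K
      by (simp add: pop_Suc exp_sum[symmetric] sum_distrib_left sum_divide_distrib)
    have "(\<integral>\<^sup>+ K. ennreal (exp (s * pop (Suc n) K)) \<partial>counts)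
        = (\<integral>\<^sup>+ K. (\<Prod>i<K []. ennreal (exp (s / m * pop n (subcounts [i] K)))) \<partial>counts)"
      unfolding exp_eq by (simp add: prod_ennreal)
    also have "\<dots> = (\<Sum>k\<le>B. ennreal (pmf q k) * (\<integral>\<^sup>+ K. ennreal (exp (s / m * pop n K)) \<partial>counts) ^ k)"
      by (rule nn_integral_prod_subcounts[where h = "\<lambda>K. exp (s / m * pop n K)"]) simp_all
    also have "\<dots> \<le> (\<Sum>k\<le>B. ennreal (pmf q k) * ennreal (exp t) ^ k)"
      unfolding t_def using Suc.IH[of "s / m"] sm Suc.prems
      by (intro sum_mono mult_left_mono power_mono) auto
    also have "\<dots> = ennreal (\<Sum>k\<le>B. pmf q k * exp (real k * t))"
      by (simp add: ennreal_power exp_of_nat_mult ennreal_mult'[symmetric] sum_ennreal)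
    also have "\<dots> \<le> ennreal (exp (m * t + (real B * t)\<^sup>2))"
      by (intro ennreal_leI sum_pmf_exp_le t Bt)
    also have "\<dots> \<le> ennreal (exp (s + C * s\<^sup>2))"
    proof -
      have "(real B * t)\<^sup>2 \<le> (real B * (2 * (s / m)))\<^sup>2"
        using t by (intro power_mono mult_left_mono) auto
      also have "\<dots> = (2 * real B / m)\<^sup>2 * s\<^sup>2"
        by (simp add: power_mult_distrib power_divide)
      finally have "m * t + (real B * t)\<^sup>2 \<le> s + (C / m + (2 * real B / m)\<^sup>2) * s\<^sup>2"
        using m_gt_1 by (simp add: t_def algebra_simps power2_eq_square)
      also have "\<dots> \<le> s + C * s\<^sup>2"
        using Cm by (intro add_left_mono mult_right_mono) auto
      finally show ?thesis by (simp add: ennreal_leI)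
    qed
    finally show ?case .
  qed
  have C_s0: "C * s0\<^sup>2 \<le> 1"
  proof -
    have "C * s0\<^sup>2 = (C * s0) * s0" by (simp add: power2_eq_square)
    also have "\<dots> \<le> 1 * 1"
      using s0 C by (intro mult_mono) (auto simp: s0_def min_def field_simps)
    finally show ?thesis by simp
  qed
  have "(\<integral>\<^sup>+ K. ennreal (exp (s0 * pop n K)) \<partial>counts) \<le> ennreal (exp (s0 + 1))" for n
  proof -
    have "(\<integral>\<^sup>+ K. ennreal (exp (s0 * pop n K)) \<partial>counts) \<le> ennreal (exp (s0 + C * s0\<^sup>2))"
      using s0(1) by (intro main) auto
    also have "\<dots> \<le> ennreal (exp (s0 + 1))"
      using C_s0 by (intro ennreal_leI) simp
    finally show ?thesis .
  qed
  with s0(1) show ?thesis by blast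
qed

text \<open>Fatou's lemma carries the uniform exponential moment over to \<open>growth\<close>, and
  the fourth power of \<open>y \<le> exp y\<close> at \<open>y = s * growth K / 4\<close> bounds the
  fourth moment by it.\<close>

lemma integrable_growth_power4: "integrable counts (\<lambda>K. growth K ^ 4)"
proof -
  obtain s where s: "s > 0" "\<And>n. (\<integral>\<^sup>+ K. ennreal (exp (s * pop n K)) \<partial>counts) \<le> ennreal (exp (s + 1))"
    using ex_exp_moment_pop by blast
  have "(\<integral>\<^sup>+ K. ennreal (exp (s * growth K)) \<partial>counts)
      = (\<integral>\<^sup>+ K. liminf (\<lambda>n. ennreal (exp (s * pop n K))) \<partial>counts)"
  proof (rule nn_integral_cong_AE)
    show "AE K in counts. ennreal (exp (s * growth K)) = liminf (\<lambda>n. ennreal (exp (s * pop n K)))"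
      using AE_convergent_pop
    proof eventually_elim
      case (elim K)
      have "(\<lambda>n. ennreal (exp (s * pop n K))) \<longlonglongrightarrow> ennreal (exp (s * growth K))"
        using pop_LIMSEQ_growth[OF elim] by (intro tendsto_ennrealI tendsto_intros)
      then show ?case
        by (rule lim_imp_Liminf[symmetric, rotated]) simp
    qed
  qed
  also have "\<dots> \<le> liminf (\<lambda>n. \<integral>\<^sup>+ K. ennreal (exp (s * pop n K)) \<partial>counts)"
    by (rule nn_integral_liminf) simp
  also have "\<dots> \<le> liminf (\<lambda>n::nat. ennreal (exp (s + 1)))"
    by (rule Liminf_mono) (simp add: s(2))
  also have "\<dots> = ennreal (exp (s + 1))"
    by (rule Liminf_const) simp
  finally have exp_fin: "(\<integral>\<^sup>+ K. ennreal (exp (s * growth K)) \<partial>counts) < \<infinity>"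
    by (simp add: le_less_trans)
  have "(\<integral>\<^sup>+ K. ennreal (norm (growth K ^ 4)) \<partial>counts)
      \<le> (\<integral>\<^sup>+ K. ennreal ((4 / s) ^ 4) * ennreal (exp (s * growth K)) \<partial>counts)"
  proof (rule nn_integral_mono_AE)
    show "AE K in counts. ennreal (norm (growth K ^ 4)) \<le> ennreal ((4 / s) ^ 4) * ennreal (exp (s * growth K))"
      using AE_growth_pos
    proof eventually_elim
      case (elim K)
      have "s * growth K / 4 \<le> exp (s * growth K / 4)"
        using exp_ge_add_one_self[of "s * growth K / 4"] by linarith
      then have "(s * growth K / 4) ^ 4 \<le> exp (s * growth K / 4) ^ 4"
        using elim s by (intro power_mono) auto
      also have "\<dots> = exp (s * growth K)"
        by (simp add: exp_of_nat_mult[symmetric])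
      finally have "(4 / s) ^ 4 * (s * growth K / 4) ^ 4 \<le> (4 / s) ^ 4 * exp (s * growth K)"
        using s by (intro mult_left_mono) auto
      also have "(4 / s) ^ 4 * (s * growth K / 4) ^ 4 = growth K ^ 4"
        using s by (simp add: power_mult_distrib[symmetric])
      finally show ?case
        using s by (simp add: ennreal_mult[symmetric] ennreal_leI)
    qed
  qed
  also have "\<dots> < \<infinity>"
    using exp_fin by (subst nn_integral_cmult) (auto simp: ennreal_mult_less_top)
  finally show ?thesis
    by (intro integrableI_bounded) simp_all
qed

text \<open>The law of large numbers for the squared growth of the subtrees at level
  \<open>n\<close>. The centred square has finite variance by the fourth moment, and the mean
  contributes \<open>c\<close> times the population, which is of order \<open>m ^ n\<close>.\<close>

lemma AE_gen_sum_growth_sq_bounded: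
  "AE K in counts. \<exists>C. \<forall>n. gen_sum (\<lambda>K. (growth K)\<^sup>2) n K \<le> C * m ^ n"
proof -
  have sq: "integrable counts (\<lambda>K. (growth K)\<^sup>2)"
  proof (rule Bochner_Integration.integrable_bound)
    show "integrable counts (\<lambda>K. 1 + growth K ^ 4)"
      using integrable_growth_power4 by simp
    have "x\<^sup>2 \<le> 1 + x ^ 4" for x :: real
      using sum_squares_bound[of "x\<^sup>2" 1] by (simp add: power2_eq_square power4_eq_xxxx) (smt (verit) mult.assoc zero_le_square)
    then show "AE K in counts. norm ((growth K)\<^sup>2) \<le> norm (1 + growth K ^ 4)"
      by (simp add: abs_of_nonneg)
  qed simp
  define c where "c = (\<integral> K. (growth K)\<^sup>2 \<partial>counts)"
  \<comment> \<open>The factor 1 presents \<open>Y\<close> as a difference to which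
    \<open>gen_sum_diff\<close> applies, with the generation size as second sum.\<close>
  define Y where "Y K = (growth K)\<^sup>2 - c * 1" for K
  have Y: "integrable counts Y"
    unfolding Y_def using sq by simp
  have Y2: "integrable counts (\<lambda>K. (Y K)\<^sup>2)"
    unfolding Y_def power2_diff
    using sq integrable_growth_power4 by (simp flip: power_mult)
  have mean: "(\<integral> K. Y K \<partial>counts) = 0"
    unfolding Y_def using sq by (simp add: c_def)
  have "AE K in counts. Bseq (\<lambda>n. \<bar>gen_sum Y n K\<bar> / m ^ n)"
    using AE_summable_gen_sum[OF Y Y2 mean] by eventually_elim (intro convergent_imp_Bseq convergentI[OF summable_LIMSEQ_zero])
  then show ?thesis
    using AE_convergent_pop
  proof eventually_elim
    case (elim K)
    obtain C1 where C1: "\<And>n. norm (\<bar>gen_sum Y n K\<bar> / m ^ n) \<le> C1"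
      using elim(1) by (auto simp: Bseq_def)
    obtain C2 where C2: "\<And>n. norm (pop n K) \<le> C2"
      using convergent_imp_Bseq[OF elim(2)] by (auto simp: Bseq_def)
    have "gen_sum (\<lambda>K. (growth K)\<^sup>2) n K \<le> (C1 + \<bar>c\<bar> * C2) * m ^ n" for n
    proof -
      have "gen_sum Y n K = gen_sum (\<lambda>K. (growth K)\<^sup>2) n K - c * (pop n K * m ^ n)"
        unfolding Y_def using gen_sum_diff[of "\<lambda>K. (growth K)\<^sup>2" c "\<lambda>_. 1" n K] m_gt_1 by (simp add: pop_def)
      moreover have "gen_sum Y n K \<le> C1 * m ^ n"
        using C1[of n] m_gt_1 by (simp add: divide_le_eq)
      moreover have "c * (pop n K * m ^ n) \<le> \<bar>c\<bar> * C2 * m ^ n"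
      proof -
        have "c * pop n K \<le> \<bar>c\<bar> * C2"
          using C2[of n] pop_nonneg[of n K] by (intro mult_mono) auto
        then show ?thesis
          using m_gt_1 mult_right_mono[of "c * pop n K" "\<bar>c\<bar> * C2" "m ^ n"] by (simp add: mult.assoc)
      qed
      ultimately show ?thesis
        by (simp add: distrib_right)
    qed
    then show ?case by blast
  qed
qed

end

section \<open>Almost sure properties of the tree\<close>

lemma Nil_in_tree_of_counts [simp]: "[] \<in> tree_of_counts K"
  by (simp add: tree_of_counts_def)

lemma snoc_in_tree_of_counts: "v @ [k] \<in> tree_of_counts K \<longleftrightarrow> v \<in> tree_of_counts K \<and> k < K v"
  by (auto simp: tree_of_counts_def less_Suc_eq nth_append)

lemma append_in_tree_of_counts:
  "v @ u \<in> tree_of_counts K \<longleftrightarrow> v \<in> tree_of_counts K \<and> u \<in> tree_of_counts (subcounts v K)"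
proof (induction u rule: rev_induct)
  case (snoc k u)
  have "v @ u @ [k] \<in> tree_of_counts K \<longleftrightarrow> v @ u \<in> tree_of_counts K \<and> k < K (v @ u)"
    using snoc_in_tree_of_counts[of "v @ u" k K] by simp
  with snoc show ?case
    by (auto simp: snoc_in_tree_of_counts subcounts_apply)
qed simp

lemma Cons_in_tree_of_counts:
  "i # u \<in> tree_of_counts K \<longleftrightarrow> i < K [] \<and> u \<in> tree_of_counts (subcounts [i] K)"
  using append_in_tree_of_counts[of "[i]" u K] snoc_in_tree_of_counts[of "[]" i K] by simp

text \<open>Splitting words by their first letter matches the recursion of \<open>gen_sum\<close>
  with the levels of the tree.\<close>

lemma gen_sum_eq_sum_tree:
  "finite {u \<in> tree_of_counts K. length u = n} \<and>
    gen_sum Y n K = (\<Sum>u\<in>{u \<in> tree_of_counts K. length u = n}. Y (subcounts u K))"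
proof (induction n arbitrary: K)
  case 0
  have "{u \<in> tree_of_counts K. length u = 0} = {[]}" by auto
  then show ?case by simp
next
  case (Suc n)
  let ?L = "\<lambda>i. {u \<in> tree_of_counts (subcounts [i] K). length u = n}"
  have eq: "{u \<in> tree_of_counts K. length u = Suc n} = (\<lambda>(i, u). i # u) ` (SIGMA i:{..<K []}. ?L i)"
    by (auto simp: Cons_in_tree_of_counts length_Suc_conv image_iff)
  have inj: "inj_on (\<lambda>(i, u). i # u) (SIGMA i:{..<K []}. ?L i)"
    by (auto simp: inj_on_def)
  have fin: "finite (SIGMA i:{..<K []}. ?L i)"
    using Suc by (intro finite_SigmaI) auto
  have "gen_sum Y (Suc n) K = (\<Sum>i<K []. \<Sum>u\<in>?L i. Y (subcounts u (subcounts [i] K)))"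
    using Suc by simp
  also have "\<dots> = (\<Sum>(i, u)\<in>(SIGMA i:{..<K []}. ?L i). Y (subcounts (i # u) K))"
    using Suc by (subst sum.Sigma) auto
  also have "\<dots> = (\<Sum>u\<in>{u \<in> tree_of_counts K. length u = Suc n}. Y (subcounts u K))"
    unfolding eq by (subst sum.reindex[OF inj]) (simp add: case_prod_unfold)
  finally show ?case
    using fin by (simp add: eq)
qed

definition words :: "nat \<Rightarrow> nat \<Rightarrow> nat list set" where
  "words B n = {u. set u \<subseteq> {..<B} \<and> length u = n}"

lemma finite_words [simp]: "finite (words B n)"
  unfolding words_def by (rule finite_lists_length_eq) simp

lemma words_Suc: "words B (Suc n) = (\<lambda>(k, u). k # u) ` ({..<B} \<times> words B n)"
  by (auto simp: words_def length_Suc_conv image_iff)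

lemma set_tree_of_counts:
  assumes "\<forall>v. K v \<le> B" "u \<in> tree_of_counts K"
  shows "set u \<subseteq> {..<B}"
  using assms(2)
  by (induction u rule: rev_induct)
    (use assms(1) in \<open>auto simp: snoc_in_tree_of_counts intro: less_le_trans\<close>)

lemma measurable_mem_tree [measurable]: "Measurable.pred tree_space (\<lambda>T. v \<in> T)"
proof -
  have "{T. v \<in> T} \<in> sets tree_space"
    unfolding tree_space_def by (rule in_measure_of) auto
  then show ?thesis by (simp add: pred_def)
qed

section \<open>Almost sure conditions stated for the tree alone\<close>

context offspring
begin

text \<open>The law \<open>galton_watson q\<close> lives on sets of words, where the counts are no
  longer available. Summing indicators over the fixed finite set \<open>words B n\<close> gives a
  version of \<open>pop\<close> that is measurable in \<open>T\<close>.\<close>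

definition subtree_pop :: "nat list set \<Rightarrow> nat list \<Rightarrow> nat \<Rightarrow> real" where
  "subtree_pop T v n = (\<Sum>u\<in>words B n. indicator {T. v @ u \<in> T} T) / m ^ n"

definition subtree_growth :: "nat list set \<Rightarrow> nat list \<Rightarrow> real" where
  "subtree_growth T v = lim (subtree_pop T v)"

text \<open>Everything the deterministic argument needs of \<open>T\<close>. Cauchy sequences,
  countable quantifiers and a natural number as the constant keep the condition measurable, as
  transferring it from counts to trees requires.\<close>

definition good_tree :: "nat list set \<Rightarrow> bool" where
  "good_tree T \<longleftrightarrow> [] \<in> T \<and> (\<forall>v k. v @ [k] \<in> T \<longrightarrow> v \<in> T \<and> k < B) \<and>
    (\<forall>v. v \<in> T \<longrightarrow> Cauchy (subtree_pop T v) \<and> subtree_growth T v > 0) \<and>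
    (\<exists>C::nat. \<forall>n. (\<Sum>u\<in>words B n. indicator {T. u \<in> T} T * (subtree_growth T u)\<^sup>2) \<le> real C * m ^ n)"

lemma measurable_subtree_pop [measurable]: "(\<lambda>T. subtree_pop T v n) \<in> borel_measurable tree_space"
  unfolding subtree_pop_def by measurable

lemma measurable_subtree_growth [measurable]: "(\<lambda>T. subtree_growth T v) \<in> borel_measurable tree_space"
  unfolding subtree_growth_def by (rule borel_measurable_lim_metric) measurable

lemma measurable_good_tree: "Measurable.pred tree_space good_tree"
proof -
  have [measurable]: "Measurable.pred tree_space (\<lambda>T. Cauchy (subtree_pop T v))" for v
    using sets_Collect_Cauchy[of "\<lambda>n T. subtree_pop T v n" tree_space]
    by (simp add: pred_def)
  show ?thesis
    unfolding good_tree_def[abs_def] by measurable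
qed

lemma subtree_pop_eq:
  assumes K: "\<forall>v. K v \<le> B" and v: "v \<in> tree_of_counts K"
  shows "subtree_pop (tree_of_counts K) v n = pop n (subcounts v K)"
proof -
  let ?T = "tree_of_counts (subcounts v K)"
  have bounded: "\<forall>u. subcounts v K u \<le> B"
    using K by (simp add: subcounts_apply)
  have "(\<Sum>u\<in>words B n. indicator {T. v @ u \<in> T} (tree_of_counts K)) = (\<Sum>u\<in>words B n. if u \<in> ?T then 1 else 0 :: real)"
    using v by (intro sum.cong) (auto simp: append_in_tree_of_counts)
  also have "\<dots> = (\<Sum>u\<in>{u \<in> words B n. u \<in> ?T}. 1)"
    by (rule sum.inter_filter[symmetric]) simp
  also have "{u \<in> words B n. u \<in> ?T} = {u \<in> ?T. length u = n}"
    using set_tree_of_counts[OF bounded] by (auto simp: words_def)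
  also have "(\<Sum>u\<in>{u \<in> ?T. length u = n}. 1) = gen_sum (\<lambda>_. 1) n (subcounts v K)"
    using gen_sum_eq_sum_tree[of "subcounts v K" n "\<lambda>_. 1"] by simp
  finally show ?thesis
    by (simp add: subtree_pop_def pop_def)
qed

lemma AE_good_tree: "AE T in galton_watson q. good_tree T"
proof -
  have "AE K in counts. good_tree (tree_of_counts K)"
  proof -
    have "AE K in counts. \<forall>v. growth (subcounts v K) > 0"
      by (subst AE_all_countable) (intro allI AE_subcounts AE_growth_pos)
    then show ?thesis
      using AE_count_le AE_convergent_pop_subcounts AE_gen_sum_growth_sq_bounded
    proof eventually_elim
      case (elim K)
      note pos = elim(1) and K = elim(2) and conv = elim(3)
      let ?T = "tree_of_counts K"
      have pop: "subtree_pop ?T v = (\<lambda>n. pop n (subcounts v K))" if "v \<in> ?T" for v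
        using subtree_pop_eq[OF K that] by auto
      have growth: "subtree_growth ?T v = growth (subcounts v K)" if "v \<in> ?T" for v
        by (simp add: subtree_growth_def growth_def pop[OF that])
      obtain C where C: "\<And>n. gen_sum (\<lambda>K. (growth K)\<^sup>2) n K \<le> C * m ^ n"
        using elim(4) by blast
      have "(\<Sum>u\<in>words B n. indicator {T. u \<in> T} ?T * (subtree_growth ?T u)\<^sup>2) \<le> real (nat \<lceil>C\<rceil>) * m ^ n" for n
      proof -
        have "(\<Sum>u\<in>words B n. indicator {T. u \<in> T} ?T * (subtree_growth ?T u)\<^sup>2)
            = (\<Sum>u\<in>words B n. if u \<in> ?T then (growth (subcounts u K))\<^sup>2 else 0)"
          by (intro sum.cong) (auto simp: growth)
        also have "\<dots> = (\<Sum>u\<in>{u \<in> words B n. u \<in> ?T}. (growth (subcounts u K))\<^sup>2)"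
          by (rule sum.inter_filter[symmetric]) simp
        also have "{u \<in> words B n. u \<in> ?T} = {u \<in> ?T. length u = n}"
          using set_tree_of_counts[OF K] by (auto simp: words_def)
        also have "(\<Sum>u\<in>{u \<in> ?T. length u = n}. (growth (subcounts u K))\<^sup>2) = gen_sum (\<lambda>K. (growth K)\<^sup>2) n K"
          using gen_sum_eq_sum_tree[of K n "\<lambda>K. (growth K)\<^sup>2"] by simp
        also have "\<dots> \<le> C * m ^ n" by (rule C)
        also have "\<dots> \<le> real (nat \<lceil>C\<rceil>) * m ^ n"
          using m_gt_1 by (intro mult_right_mono) (auto intro: real_nat_ceiling_ge)
        finally show ?thesis .
      qed
      moreover have "v \<in> ?T \<and> k < B" if "v @ [k] \<in> ?T" for v k
        using that K by (auto simp: snoc_in_tree_of_counts intro: less_le_trans)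
      moreover have "Cauchy (subtree_pop ?T v) \<and> subtree_growth ?T v > 0" if "v \<in> ?T" for v
        using conv pos by (simp add: pop[OF that] growth[OF that] convergent_Cauchy)
      ultimately show ?case
        unfolding good_tree_def by (intro conjI) (simp, blast, blast, blast)
    qed
  qed
  then show ?thesis
    using measurable_good_tree
    unfolding galton_watson_def counts_def pred_def
    by (subst AE_distr_iff[OF measurable_tree_of_counts]) auto
qed

section \<open>Consequences for a fixed good tree\<close>

context
  fixes T :: "nat list set"
  assumes T: "good_tree T"
begin

lemma good_tree_root: "[] \<in> T"
  and good_tree_snoc: "v @ [k] \<in> T \<Longrightarrow> v \<in> T \<and> k < B"
  and good_tree_growth_pos: "v \<in> T \<Longrightarrow> subtree_growth T v > 0"
  and good_tree_square: "\<exists>C. \<forall>n. (\<Sum>u\<in>words B n. indicator {T. u \<in> T} T * (subtree_growth T u)\<^sup>2) \<le> C * m ^ n"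
  using T by (auto simp: good_tree_def)

lemma good_tree_LIMSEQ: "v \<in> T \<Longrightarrow> subtree_pop T v \<longlonglongrightarrow> subtree_growth T v"
  using T by (simp add: good_tree_def subtree_growth_def Cauchy_convergent_iff convergent_LIMSEQ_iff)

lemma good_tree_append: "v @ u \<in> T \<Longrightarrow> v \<in> T \<and> set u \<subseteq> {..<B}"
proof (induction u rule: rev_induct)
  case (snoc k u)
  then show ?case
    using good_tree_snoc[of "v @ u" k] by auto
qed simp

lemma good_tree_level: "{u \<in> T. length u = n} \<subseteq> words B n"
  using good_tree_append[of "[]"] by (auto simp: words_def)

text \<open>The normalised level sizes converge, hence are bounded.\<close>

lemma good_tree_card: "\<exists>C. \<forall>n. real (card {u \<in> T. length u = n}) \<le> C * m ^ n"
proof -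
  obtain C where C: "\<And>n. norm (subtree_pop T [] n) \<le> C"
    using convergent_imp_Bseq[OF convergentI[OF good_tree_LIMSEQ[OF good_tree_root]]] by (auto simp: Bseq_def)
  have "real (card {u \<in> T. length u = n}) \<le> C * m ^ n" for n
  proof -
    have "(\<Sum>u\<in>words B n. indicator {T. [] @ u \<in> T} T) = (\<Sum>u\<in>words B n. if u \<in> T then 1 else 0 :: real)"
      by (intro sum.cong) auto
    also have "\<dots> = real (card {u \<in> words B n. u \<in> T})"
      by (simp add: sum.inter_filter[symmetric])
    also have "{u \<in> words B n. u \<in> T} = {u \<in> T. length u = n}"
      using good_tree_level[of n] by (auto simp: words_def)
    finally have "subtree_pop T [] n = real (card {u \<in> T. length u = n}) / m ^ n"
      by (simp add: subtree_pop_def)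
    then show ?thesis
      using C[of n] m_gt_1 by (simp add: divide_le_eq)
  qed
  then show ?thesis by blast
qed

text \<open>Words of length \<open>n + 1\<close> are split by their first letter before
  \<open>n\<close> tends to infinity; letters leading out of \<open>T\<close> contribute nothing by
  prefix closure.\<close>

lemma subtree_growth_split:
  assumes v: "v \<in> T"
  shows "subtree_growth T v = (\<Sum>k\<in>{k. v @ [k] \<in> T}. subtree_growth T (v @ [k])) / m"
proof -
  have fin: "{k. v @ [k] \<in> T} \<subseteq> {..<B}"
    using good_tree_snoc by auto
  have "subtree_pop T v (Suc n) = (\<Sum>k\<in>{k. v @ [k] \<in> T}. subtree_pop T (v @ [k]) n) / m" for n
  proof -
    have inj: "inj_on (\<lambda>(k, u). k # u) ({..<B} \<times> words B n)"
      by (auto simp: inj_on_def)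
    have "(\<Sum>u\<in>words B (Suc n). indicator {T. v @ u \<in> T} T)
        = (\<Sum>k<B. \<Sum>u\<in>words B n. indicator {T. (v @ [k]) @ u \<in> T} T :: real)"
      unfolding words_Suc by (subst sum.reindex[OF inj]) (simp add: case_prod_unfold sum.cartesian_product)
    also have "\<dots> = (\<Sum>k\<in>{k. v @ [k] \<in> T}. \<Sum>u\<in>words B n. indicator {T. (v @ [k]) @ u \<in> T} T)"
      using fin good_tree_append by (intro sum.mono_neutral_right) (auto intro!: sum.neutral simp: indicator_def)
    finally show ?thesis
      by (simp add: subtree_pop_def sum_divide_distrib mult.commute)
  qed
  moreover have "(\<lambda>n. (\<Sum>k\<in>{k. v @ [k] \<in> T}. subtree_pop T (v @ [k]) n) / m)
      \<longlonglongrightarrow> (\<Sum>k\<in>{k. v @ [k] \<in> T}. subtree_growth T (v @ [k])) / m"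
    using m_gt_1 by (intro tendsto_intros good_tree_LIMSEQ) auto
  ultimately have "(\<lambda>n. subtree_pop T v (Suc n)) \<longlonglongrightarrow> (\<Sum>k\<in>{k. v @ [k] \<in> T}. subtree_growth T (v @ [k])) / m"
    by simp
  then show ?thesis
    using LIMSEQ_unique LIMSEQ_Suc[OF good_tree_LIMSEQ[OF v]] by blast
qed

section \<open>Transport along an embedding\<close>

context
  fixes b :: nat and \<phi> :: "nat list \<Rightarrow> (nat ^ 'd) list"
  assumes b: "b > 1" and \<phi>: "tree_embedding b T \<phi>"
begin

lemma embedding_Nil: "\<phi> [] = []"
  and embedding_inj: "inj_on \<phi> T"
  and embedding_snoc: "v @ [k] \<in> T \<Longrightarrow> \<exists>w\<in>digits b. \<phi> (v @ [k]) = \<phi> v @ [w]"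
  using \<phi> unfolding tree_embedding_def by blast+

lemma length_embedding: "v \<in> T \<Longrightarrow> length (\<phi> v) = length v \<and> set (\<phi> v) \<subseteq> digits b"
proof (induction v rule: rev_induct)
  case (snoc k v)
  then show ?case
    using good_tree_snoc[of v k] embedding_snoc[of v k] by auto
qed (simp add: embedding_Nil)

text \<open>An embedding appends one digit per generation, so the parent of an image vertex is the
  image of the parent.\<close>

lemma snoc_in_embedding:
  assumes "u @ [w] \<in> \<phi> ` T"
  obtains v k where "v @ [k] \<in> T" "u = \<phi> v" "u @ [w] = \<phi> (v @ [k])"
proof -
  obtain x where x: "x \<in> T" "u @ [w] = \<phi> x"
    using assms by auto
  then have "x \<noteq> []"
    using embedding_Nil by auto
  then obtain v k where vk: "x = v @ [k]"
    by (metis append_butlast_last_id)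
  then have "u = \<phi> v"
    using embedding_snoc[of v k] x by auto
  then show thesis
    using that x vk by auto
qed

lemma digit_tree_embedding: "digit_tree b (\<phi> ` T)"
proof
  show "1 < b" by (rule b)
  show "\<phi> ` T \<subseteq> lists (digits b)"
    using length_embedding by auto
  show "[] \<in> \<phi> ` T"
    using good_tree_root embedding_Nil by force
  fix u and w :: "nat ^ 'd" assume "u @ [w] \<in> \<phi> ` T"
  then show "u \<in> \<phi> ` T"
    by (rule snoc_in_embedding) (use good_tree_snoc in auto)
qed

interpretation embedded: digit_tree b "\<phi> ` T"
  by (rule digit_tree_embedding)

lemma level_embedding: "embedded.level n = \<phi> ` {u \<in> T. length u = n}"
  unfolding embedded.level_def using length_embedding by auto

text \<open>The branching measure of the rays through \<open>u\<close>, normalised to mass 1 at the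
  root. The inverse of \<open>\<phi>\<close> recovers the vertex, since flows are indexed by
  embedded words.\<close>

definition branching_flow :: "(nat ^ 'd) list \<Rightarrow> real" where
  "branching_flow u = (let v = inv_into T \<phi> u in subtree_growth T v / (m ^ length v * subtree_growth T []))"

lemma branching_flow_eq:
  "v \<in> T \<Longrightarrow> branching_flow (\<phi> v) = subtree_growth T v / (m ^ length v * subtree_growth T [])"
  by (simp add: branching_flow_def inv_into_f_f[OF embedding_inj])

text \<open>Conservation is \<open>subtree_growth_split\<close>, once the children of
  \<open>v\<close> are matched with the digits used below \<open>\<phi> v\<close>.\<close>

lemma tree_flow_embedding: "tree_flow b (\<phi> ` T) branching_flow"
proof (intro tree_flow.intro tree_flow_axioms.intro digit_tree_embedding)
  show "branching_flow [] = 1"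
    using branching_flow_eq[OF good_tree_root] good_tree_growth_pos[OF good_tree_root]
    by (simp add: embedding_Nil)
  fix x assume "x \<in> \<phi> ` T"
  then obtain v where v: "v \<in> T" "x = \<phi> v" by auto
  show "branching_flow x > 0"
    using v m_gt_1 by (simp add: branching_flow_eq good_tree_growth_pos good_tree_root)
  \<comment> \<open>\<open>e k\<close> is the digit that the embedding assigns to the
    \<open>k\<close>-th child of \<open>v\<close>.\<close>
  define e where "e k = last (\<phi> (v @ [k]))" for k
  have e: "\<phi> (v @ [k]) = \<phi> v @ [e k] \<and> e k \<in> digits b" if "v @ [k] \<in> T" for k
    using embedding_snoc[OF that] by (auto simp: e_def)
  have inj: "inj_on e {k. v @ [k] \<in> T}"
  proof (rule inj_onI)
    fix k l assume kl: "k \<in> {k. v @ [k] \<in> T}" "l \<in> {k. v @ [k] \<in> T}" "e k = e l"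
    then have "\<phi> (v @ [k]) = \<phi> (v @ [l])"
      using e by simp
    then show "k = l"
      using kl inj_onD[OF embedding_inj] by blast
  qed
  \<comment> \<open>Injectivity of \<open>\<phi>\<close> excludes that an embedded child of
    \<open>\<phi> v\<close> stems from a vertex other than \<open>v\<close>.\<close>
  have image: "{w \<in> digits b. \<phi> v @ [w] \<in> \<phi> ` T} = e ` {k. v @ [k] \<in> T}"
  proof (intro set_eqI iffI)
    fix w assume "w \<in> {w \<in> digits b. \<phi> v @ [w] \<in> \<phi> ` T}"
    then have "\<phi> v @ [w] \<in> \<phi> ` T" by simp
    then obtain v' k where v': "v' @ [k] \<in> T" "\<phi> v = \<phi> v'" "\<phi> v @ [w] = \<phi> (v' @ [k])"
      by (rule snoc_in_embedding)
    then have "v' = v"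
      using inj_onD[OF embedding_inj] good_tree_snoc v(1) by metis
    with v' have "v @ [k] \<in> T" "w = e k"
      using e[of k] by auto
    then show "w \<in> e ` {k. v @ [k] \<in> T}" by blast
  next
    fix w assume "w \<in> e ` {k. v @ [k] \<in> T}"
    then obtain k where k: "v @ [k] \<in> T" "w = e k" by blast
    then have "\<phi> v @ [w] = \<phi> (v @ [k])" "w \<in> digits b"
      using e[of k] by auto
    with k(1) show "w \<in> {w \<in> digits b. \<phi> v @ [w] \<in> \<phi> ` T}"
      by simp
  qed
  have "(\<Sum>w\<in>{w \<in> digits b. x @ [w] \<in> \<phi> ` T}. branching_flow (x @ [w]))
      = (\<Sum>k\<in>{k. v @ [k] \<in> T}. branching_flow (\<phi> (v @ [k])))"
    unfolding v(2) image by (subst sum.reindex[OF inj]) (auto intro!: sum.cong simp: e)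
  also have "\<dots> = (\<Sum>k\<in>{k. v @ [k] \<in> T}. subtree_growth T (v @ [k]) / m / (m ^ length v * subtree_growth T []))"
    by (intro sum.cong) (auto simp: branching_flow_eq)
  also have "\<dots> = branching_flow x"
    using v subtree_growth_split[OF v(1)] by (simp add: branching_flow_eq sum_divide_distrib)
  finally show "branching_flow x = (\<Sum>w\<in>{w \<in> digits b. x @ [w] \<in> \<phi> ` T}. branching_flow (x @ [w]))" ..
qed

text \<open>Squared growth at level \<open>n\<close> sums to at most \<open>C * m ^ n\<close>, and
  normalisation divides by the square of \<open>m ^ n\<close>, leaving order
  \<open>m ^ -n\<close>.\<close>

lemma branching_flow_square: "\<exists>C. \<forall>n. (\<Sum>u\<in>embedded.level n. (branching_flow u)\<^sup>2) \<le> C / m ^ n"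
proof -
  obtain C where C: "\<And>n. (\<Sum>u\<in>words B n. indicator {T. u \<in> T} T * (subtree_growth T u)\<^sup>2) \<le> C * m ^ n"
    using good_tree_square by blast
  define W where "W = subtree_growth T []"
  have W: "W > 0"
    by (simp add: W_def good_tree_growth_pos good_tree_root)
  have "(\<Sum>u\<in>embedded.level n. (branching_flow u)\<^sup>2) \<le> C / W\<^sup>2 / m ^ n" for n
  proof -
    have "(\<Sum>u\<in>embedded.level n. (branching_flow u)\<^sup>2) = (\<Sum>v\<in>{u \<in> T. length u = n}. (branching_flow (\<phi> v))\<^sup>2)"
      unfolding level_embedding
      by (subst sum.reindex) (auto intro: inj_on_subset[OF embedding_inj])
    also have "\<dots> = (\<Sum>v\<in>{u \<in> T. length u = n}. (subtree_growth T v)\<^sup>2) / (m ^ n * W)\<^sup>2"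
      unfolding sum_divide_distrib by (intro sum.cong) (auto simp: branching_flow_eq W_def power_divide)
    also have "(\<Sum>v\<in>{u \<in> T. length u = n}. (subtree_growth T v)\<^sup>2)
        = (\<Sum>u\<in>words B n. if u \<in> T then (subtree_growth T u)\<^sup>2 else 0)"
    proof -
      have eq: "{u \<in> T. length u = n} = {u \<in> words B n. u \<in> T}"
        using good_tree_level[of n] by (auto simp: words_def)
      show ?thesis
        unfolding eq by (rule sum.inter_filter) simp
    qed
    also have "\<dots> = (\<Sum>u\<in>words B n. indicator {T. u \<in> T} T * (subtree_growth T u)\<^sup>2)"
      by (intro sum.cong) auto
    also have "\<dots> / (m ^ n * W)\<^sup>2 \<le> C * m ^ n / (m ^ n * W)\<^sup>2"
      by (intro divide_right_mono C) simp
    also have "\<dots> = C / W\<^sup>2 / m ^ n"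
      using m_gt_1 W by (simp add: power2_eq_square field_simps)
    finally show ?thesis .
  qed
  then show ?thesis by blast
qed

lemma capacity_pos_iff:
  assumes g: "gauge_function g"
  shows "gauge_capacity g (base_expansion b ` tree_boundary (\<phi> ` T)) > 0 \<longleftrightarrow>
    (\<Sum>n. ennreal (g (1 / real b ^ Suc n) / m ^ Suc n)) < \<infinity>"
proof -
  interpret flow: tree_flow b "\<phi> ` T" branching_flow
    by (rule tree_flow_embedding)
  obtain C where C: "\<And>n. real (card {u \<in> T. length u = n}) \<le> C * m ^ n"
    using good_tree_card by blast
  have "card (embedded.level n) = card {u \<in> T. length u = n}" for n
    unfolding level_embedding by (intro card_image inj_on_subset[OF embedding_inj]) auto
  then have card: "real (card (embedded.level n)) \<le> C * m ^ n" for n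
    using C by simp
  obtain C' where C': "\<And>n. (\<Sum>u\<in>embedded.level n. (branching_flow u)\<^sup>2) \<le> C' / m ^ n"
    using branching_flow_square by blast
  show ?thesis
    using embedded.summable_of_capacity_pos[OF g m_gt_1 card] flow.capacity_pos_of_summable[OF g m_gt_1 C']
    by blast
qed

end

end

end

theorem corollary4p3:
  fixes b :: nat and q :: "nat pmf" and m :: real
  assumes "b > 1"
    and "pmf q 0 = 0"
    and "pmf q 1 \<noteq> 1"
    and "\<forall>i > b ^ CARD('d::finite). pmf q i = 0"
    and "m = (\<Sum>n. real n * pmf q n)"
  shows "AE T in galton_watson q.
    \<forall>\<phi> :: nat list \<Rightarrow> (nat ^ 'd) list. tree_embedding b T \<phi> \<longrightarrow>
      (let \<Lambda> = base_expansion b ` tree_boundary (\<phi> ` T) in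
        \<forall>g. gauge_function g \<longrightarrow>
          (gauge_capacity g \<Lambda> > 0 \<longleftrightarrow>
           (\<Sum>n. ennreal (g (1 / real b ^ Suc n) / m ^ Suc n)) < \<infinity>))"
proof -
  interpret offspring q "b ^ CARD('d)" m
    by unfold_locales (use assms in auto)
  show ?thesis
    \<comment> \<open>\<open>good_tree\<close> mentions neither \<open>\<phi>\<close> nor
      \<open>g\<close>, so a single null set serves all embeddings and all gauge functions.\<close>
    using AE_good_tree
  proof eventually_elim
    case (elim T)
    show ?case
      unfolding Let_def by (intro allI impI capacity_pos_iff elim assms(1))
  qed
qed

end
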